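(* Let $\mathfrak g$ be a $2$-step nilpotent real Lie algebra, let $G=(\mathfrak g,* )$ with $x*y=x+y+\frac12[x,y]$, and let $(\Delta,\rho)$ be a sub-Riemannian structure on $G$, with $$V=\{v\in\Delta_e:\rho(v,w)=0\text{ for every }w\in\Delta_e\cap[\mathfrak g,\mathfrak g]\}.$$ Fix a norm $\lvert\cdot\rvert$ on $[\mathfrak g,\mathfrak g]$. Then there exists $C>0$ such that for every $u\in L^2([0,1],\Delta_e)$ and every $\zeta\in[\mathfrak g,\mathfrak g]$, there exists $v\in L^2([0,1],V)$ such that (i) $\gamma_{u+v}(1)=\gamma_u(1)+\zeta$, (ii) $\int_0^1\rho_e(v(t),u(t))\,dt=0$, (iii) $\int_0^1\rho_e(v(t),v(t))\,dt\le C\lvert\zeta\rvert$.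
   Context: $\mathfrak g$ is finite-dimensional with $[\mathfrak g,[\mathfrak g,\mathfrak g]]=0$ and $[\mathfrak g,\mathfrak g]\ne0$. The Lie algebra of $G=(\mathfrak g,* )$ is $\mathfrak g$, the exponential map is the identity, and the identity element is $e=0$. A sub-Riemannian structure $(\Delta,\rho)$ on $G$ consists of a left-invariant subbundle $\Delta\subseteq TG$ such that $\Delta_e\subseteq\mathfrak g$ generates $\mathfrak g$ as a Lie algebra, and a left-invariant metric tensor $\rho$ on $\Delta$ (extending an inner product $\rho_e$ on $\Delta_e$). For $u\in L^1([0,1],\mathfrak g)$, $\gamma_u:[0,1]\to G$ denotes the absolutely continuous curve with $\gamma_u(0)=e$ and $\dot\gamma_u(t)=dL_{\gamma_u(t)}(u(t))$ for a.e. $t$, where $L_p$ is left translation by $p$. The sum $\gamma_u(1)+\zeta$ is taken in the vector space $\mathfrak g$. *)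

theory Defs
  imports "HOL-Analysis.Analysis"
begin

text \<open>
  Finite-dimensional real Lie algebras are bracket operations on a type of class
  \<^class>\<open>euclidean_space\<close>.  The inner product of that class is auxiliary: it only supplies the
  (unique) vector space topology and measurable structure.
\<close>

definition lie_algebra :: "('g::euclidean_space \<Rightarrow> 'g \<Rightarrow> 'g) \<Rightarrow> bool" where
  "lie_algebra br \<longleftrightarrow>
     bilinear br \<and>
     (\<forall>x. br x x = 0) \<and>
     (\<forall>x y z. br x (br y z) + br y (br z x) + br z (br x y) = 0)"

definition bracket_span :: "('g::euclidean_space \<Rightarrow> 'g \<Rightarrow> 'g) \<Rightarrow> 'g set \<Rightarrow> 'g set \<Rightarrow> 'g set" where
  "bracket_span br A B = span {br a b | a b. a \<in> A \<and> b \<in> B}"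

definition derived_algebra :: "('g::euclidean_space \<Rightarrow> 'g \<Rightarrow> 'g) \<Rightarrow> 'g set" where
  "derived_algebra br = bracket_span br UNIV UNIV"

definition two_step_nilpotent :: "('g::euclidean_space \<Rightarrow> 'g \<Rightarrow> 'g) \<Rightarrow> bool" where
  "two_step_nilpotent br \<longleftrightarrow>
     lie_algebra br \<and>
     bracket_span br UNIV (derived_algebra br) = {0} \<and>
     derived_algebra br \<noteq> {0}"

definition lie_subalgebra :: "('g::euclidean_space \<Rightarrow> 'g \<Rightarrow> 'g) \<Rightarrow> 'g set \<Rightarrow> bool" where
  "lie_subalgebra br S \<longleftrightarrow> subspace S \<and> (\<forall>x\<in>S. \<forall>y\<in>S. br x y \<in> S)"

definition group_mult :: "('g::euclidean_space \<Rightarrow> 'g \<Rightarrow> 'g) \<Rightarrow> 'g \<Rightarrow> 'g \<Rightarrow> 'g" where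
  "group_mult br x y = x + y + (1/2) *\<^sub>R br x y"

text \<open>
  The manifold underlying \<open>G\<close> is the vector space itself, so every tangent space is identified
  with \<open>'g\<close>.  The differential at \<open>q\<close> of the left translation by \<open>p\<close>, a map from the tangent
  space at \<open>q\<close> to the one at \<open>p * q\<close>, is its Frechet derivative.
\<close>

definition dL :: "('g::euclidean_space \<Rightarrow> 'g \<Rightarrow> 'g) \<Rightarrow> 'g \<Rightarrow> 'g \<Rightarrow> 'g \<Rightarrow> 'g" where
  "dL br p q = frechet_derivative (group_mult br p) (at q)"

definition inner_product_on :: "'g::real_vector set \<Rightarrow> ('g \<Rightarrow> 'g \<Rightarrow> real) \<Rightarrow> bool" where
  "inner_product_on S b \<longleftrightarrow>
     (\<forall>x\<in>S. \<forall>y\<in>S. b x y = b y x) \<and>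
     (\<forall>x\<in>S. \<forall>y\<in>S. \<forall>z\<in>S. b (x + y) z = b x z + b y z) \<and>
     (\<forall>c. \<forall>x\<in>S. \<forall>y\<in>S. b (c *\<^sub>R x) y = c * b x y) \<and>
     (\<forall>x\<in>S. x \<noteq> 0 \<longrightarrow> b x x > 0)"

definition norm_on :: "'g::real_vector set \<Rightarrow> ('g \<Rightarrow> real) \<Rightarrow> bool" where
  "norm_on S N \<longleftrightarrow>
     (\<forall>x\<in>S. N x \<ge> 0) \<and>
     (\<forall>x\<in>S. N x = 0 \<longleftrightarrow> x = 0) \<and>
     (\<forall>c. \<forall>x\<in>S. N (c *\<^sub>R x) = \<bar>c\<bar> * N x) \<and>
     (\<forall>x\<in>S. \<forall>y\<in>S. N (x + y) \<le> N x + N y)"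

text \<open>
  \<open>\<Delta> p\<close> is the fibre at \<open>p\<close> and \<open>\<rho> p\<close> the inner product on it; values of \<open>\<rho> p\<close> off \<open>\<Delta> p\<close> are
  irrelevant.  Smoothness and constancy of rank are consequences of left-invariance.
\<close>

definition sub_riemannian ::
  "('g::euclidean_space \<Rightarrow> 'g \<Rightarrow> 'g) \<Rightarrow> ('g \<Rightarrow> 'g set) \<Rightarrow> ('g \<Rightarrow> 'g \<Rightarrow> 'g \<Rightarrow> real) \<Rightarrow> bool" where
  "sub_riemannian br \<Delta> \<rho> \<longleftrightarrow>
     (\<forall>p. subspace (\<Delta> p)) \<and>
     (\<forall>p q. \<Delta> (group_mult br p q) = dL br p q ` \<Delta> q) \<and>
     lie_subalgebra br hull \<Delta> 0 = UNIV \<and>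
     (\<forall>p. inner_product_on (\<Delta> p) (\<rho> p)) \<and>
     (\<forall>p q. \<forall>v\<in>\<Delta> q. \<forall>w\<in>\<Delta> q.
        \<rho> (group_mult br p q) (dL br p q v) (dL br p q w) = \<rho> q v w)"

definition orth_derived ::
  "('g::euclidean_space \<Rightarrow> 'g \<Rightarrow> 'g) \<Rightarrow> ('g \<Rightarrow> 'g set) \<Rightarrow> ('g \<Rightarrow> 'g \<Rightarrow> 'g \<Rightarrow> real) \<Rightarrow> 'g set" where
  "orth_derived br \<Delta> \<rho> =
     {v \<in> \<Delta> 0. \<forall>w \<in> \<Delta> 0 \<inter> derived_algebra br. \<rho> 0 v w = 0}"

text \<open>
  Members of \<open>L\<^sup>2([0,1], S)\<close> are represented by functions on the reals, determined up to null
  sets; hence values in \<open>S\<close> are required almost everywhere only.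
\<close>

definition L2_space :: "'g::euclidean_space set \<Rightarrow> (real \<Rightarrow> 'g) set" where
  "L2_space S = {u. u \<in> borel_measurable (lebesgue_on {0..1}) \<and>
     (AE t in lebesgue_on {0..1}. u t \<in> S) \<and>
     integrable (lebesgue_on {0..1}) (\<lambda>t. (norm (u t))\<^sup>2)}"

text \<open>
  Absolute continuity of functions; the \<open>absolutely_continuous\<close> of the library is about
  measures.  A division \<open>d\<close> is a finite family of non-overlapping compact intervals
  \<open>k = [Inf k, Sup k]\<close>.
\<close>

definition abs_continuous_on :: "real set \<Rightarrow> (real \<Rightarrow> 'g::euclidean_space) \<Rightarrow> bool" where
  "abs_continuous_on S f \<longleftrightarrow>
     (\<forall>\<epsilon>>0. \<exists>\<delta>>0. \<forall>d. d division_of \<Union>d \<and> \<Union>d \<subseteq> S \<and> (\<Sum>k\<in>d. Sup k - Inf k) < \<delta> \<longrightarrow>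
        (\<Sum>k\<in>d. norm (f (Sup k) - f (Inf k))) < \<epsilon>)"

definition is_curve_of ::
  "('g::euclidean_space \<Rightarrow> 'g \<Rightarrow> 'g) \<Rightarrow> (real \<Rightarrow> 'g) \<Rightarrow> (real \<Rightarrow> 'g) \<Rightarrow> bool" where
  "is_curve_of br u \<gamma> \<longleftrightarrow>
     abs_continuous_on {0..1} \<gamma> \<and> \<gamma> 0 = 0 \<and>
     (AE t in lebesgue_on {0..1}.
        (\<gamma> has_vector_derivative dL br (\<gamma> t) 0 (u t)) (at t within {0..1}))"

text \<open>
  For integrable \<open>u\<close> the curve exists and is unique on \<open>[0,1]\<close>; \<^const>\<open>extensional\<close> fixes its
  irrelevant values elsewhere, so that the description is proper.
\<close>

definition curve_of :: "('g::euclidean_space \<Rightarrow> 'g \<Rightarrow> 'g) \<Rightarrow> (real \<Rightarrow> 'g) \<Rightarrow> real \<Rightarrow> 'g" where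
  "curve_of br u = (THE \<gamma>. \<gamma> \<in> extensional {0..1} \<and> is_curve_of br u \<gamma>)"

end

theory Submission
  imports Defs
begin

text \<open>
  In a two-step nilpotent algebra the bracket annihilates the derived algebra, so the equation of
  the curve integrates explicitly: with \<open>U t = integral {0..t} u\<close>, the endpoint is
  \<open>U 1 + 1/2 \<integral> [U, u]\<close> (\<open>curve_of_endpoint\<close>). Let \<open>v\<close> be a perturbation whose primitive \<open>W\<close> is
  closed, \<open>W 1 = 0\<close>. Adding \<open>v\<close> to \<open>u\<close> moves the endpoint by
  \<open>1/2 \<integral> ([U, v] + [W, u]) + 1/2 \<integral> [W, v]\<close> (\<open>curve_of_add_endpoint\<close>). The first integral is
  linear in \<open>v\<close> and depends on \<open>u\<close>, which is arbitrary; the second is quadratic in \<open>v\<close> and does not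
  involve \<open>u\<close>. A constant that is uniform in \<open>u\<close> is therefore to be
  expected once \<open>v\<close> is chosen so that the linear term vanishes. The orthogonality to \<open>u\<close> is one more
  linear condition, so altogether there are \<open>dim \<gg> + 1\<close> of them, a number that
  is known before \<open>u\<close> is.

  The perturbation is a combination of the loops \<open>cos (2\<pi>qt) x + sin (2\<pi>qt) y\<close>. Such a loop sweeps
  out a positive multiple of \<open>[x, y]\<close>, and loops of different integer frequencies are orthogonal both
  for the energy and for the swept area (\<open>loop_sum_integrals\<close>). Hence the quadratic term of
  \<open>\<Sum> \<alpha>\<^sub>q loop\<^sub>q\<close> is a sum of the squares \<open>\<alpha>\<^sub>q\<^sup>2\<close> with positive weights: with \<open>dim \<gg> + 2\<close> frequencies
  at hand there is a nonzero choice of the \<open>\<alpha>\<^sub>q\<close> that kills all linear conditions, and since those are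
  homogeneous it can be rescaled to give any prescribed nonnegative area, at an energy
  bounded by a multiple of that area (\<open>vanishing_combination\<close>).

  It remains to write \<open>\<zeta> = \<Sum> c\<^sub>b [X\<^sub>b, Y\<^sub>b]\<close> with \<open>X\<^sub>b, Y\<^sub>b\<close> in \<open>V\<close> and \<open>c\<^sub>b\<close> bounded by a multiple of
  \<open>\<bar>\<zeta>\<bar>\<close>, and to use a separate block of frequencies for each \<open>b\<close>. Brackets of \<open>V\<close> span the derived
  algebra because \<open>\<Delta>\<^sub>e\<close> generates \<open>\<gg>\<close> and is the sum of \<open>V\<close> and a central part
  (\<open>span_bracket_orth_derived\<close>).

  For controls that are merely integrable, the formula for the endpoint rests on the fundamental
  theorem of calculus for absolutely continuous functions, in both directions
  (\<open>abs_continuous_on_has_integral\<close>, \<open>abs_continuous_on_indefinite_integral\<close> and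
  \<open>indefinite_integral_has_vector_derivative_AE\<close>).
\<close>

section \<open>Absolute continuity and the fundamental theorem of calculus\<close>

text \<open>
  The derivative is integrated as a gauge integral. Where it exists, a fine interval contributes an
  error that is small relative to its length. The fine intervals tagged in the exceptional null set
  have small total length by Henstock's lemma applied to the indicator of that set, so absolute
  continuity makes the increments of \<open>f\<close> over them negligible.
\<close>

lemma abs_continuous_on_has_integral:
  fixes f g :: "real \<Rightarrow> 'a::euclidean_space"
  assumes "a \<le> b" and ac: "abs_continuous_on {a..b} f" and neg: "negligible E"
    and der: "\<And>x. \<lbrakk>x \<in> {a..b}; x \<notin> E\<rbrakk> \<Longrightarrow> (f has_vector_derivative g x) (at x within {a..b})"
  shows "(g has_integral (f b - f a)) {a..b}"
proof -
  define h where "h x = (if x \<in> E then 0 else g x)" for x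
  have "(h has_integral (f b - f a)) (cbox a b)"
    unfolding has_integral
  proof (intro allI impI)
    fix e :: real
    assume "e > 0"
    define e1 where "e1 = e / (2 * (b - a + 1))"
    have "e1 > 0" "e1 * (b - a) < e/2"
      using \<open>e > 0\<close> \<open>a \<le> b\<close> by (auto simp: e1_def field_simps)
    obtain \<delta> where "\<delta> > 0" and \<delta>: "\<And>d. \<lbrakk>d division_of \<Union>d; \<Union>d \<subseteq> {a..b}; (\<Sum>k\<in>d. Sup k - Inf k) < \<delta>\<rbrakk>
        \<Longrightarrow> (\<Sum>k\<in>d. norm (f (Sup k) - f (Inf k))) < e/2"
      using ac[unfolded abs_continuous_on_def] \<open>e > 0\<close> by (meson half_gt_zero)
    have ind: "((indicator E :: real \<Rightarrow> real) has_integral 0) (cbox u v)" for u v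
      using neg by (simp add: negligible_def)
    obtain \<gamma> where "gauge \<gamma>"
      and \<gamma>: "\<And>p. \<lbrakk>p tagged_partial_division_of cbox a b; \<gamma> fine p\<rbrakk> \<Longrightarrow>
             (\<Sum>(x,k)\<in>p. norm(measure lborel k *\<^sub>R indicat_real E x - integral k (indicat_real E))) < \<delta>"
      using Henstock_lemma[OF has_integral_integrable[OF ind] \<open>\<delta> > 0\<close>] by blast
    have "\<forall>x. \<exists>d>0. x \<in> {a..b} - E \<longrightarrow>
         (\<forall>y\<in>{a..b}. norm (y-x) < d \<longrightarrow> norm (f y - f x - (y-x) *\<^sub>R g x) \<le> e1 * norm (y-x))"
      using der[unfolded has_vector_derivative_def has_derivative_within_alt] \<open>e1 > 0\<close> 
      by (metis DiffE zero_less_one)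
    then obtain d where d: "\<And>x. 0 < d x"
      "\<And>x y. \<lbrakk>x \<in> {a..b}; x \<notin> E; y \<in> {a..b}; norm (y-x) < d x\<rbrakk>
                        \<Longrightarrow> norm (f y - f x - (y-x) *\<^sub>R g x) \<le> e1 * norm (y-x)"
      by (metis DiffI)
    show "\<exists>\<gamma>. gauge \<gamma> \<and> (\<forall>p. p tagged_division_of cbox a b \<and> \<gamma> fine p \<longrightarrow>
            norm ((\<Sum>(x, k)\<in>p. measure lborel k *\<^sub>R h x) - (f b - f a)) < e)"
    proof (rule exI[of _ "\<lambda>x. ball x (d x) \<inter> \<gamma> x"], intro conjI allI impI; (elim conjE)?)
      show "gauge (\<lambda>x. ball x (d x) \<inter> \<gamma> x)"
        using d(1) \<open>gauge \<gamma>\<close> gauge_Int gauge_ball_dependent by blast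
    next
      fix p
      assume ptag: "p tagged_division_of cbox a b" and "(\<lambda>x. ball x (d x) \<inter> \<gamma> x) fine p"
      then have fine: "(\<lambda>x. ball x (d x)) fine p" "\<gamma> fine p"
        by (auto simp: fine_Int)
      have "finite p" using ptag by blast
      have Icc: "\<exists>u v. K = {u..v} \<and> u \<le> v \<and> u \<in> {a..b} \<and> v \<in> {a..b} \<and> x \<in> {u..v}" if "(x,K) \<in> p" for x K
      proof -
        have "x \<in> K" "K \<subseteq> cbox a b" "\<exists>u v. K = cbox u v" using ptag that by blast+
        then show ?thesis by (auto simp: subset_iff) 
      qed
      \<comment> \<open>The two kinds of tags are estimated separately, each contributing at most \<open>e/2\<close>.\<close>
      define p1 where "p1 = {(x,K) \<in> p. x \<notin> E}"
      define p2 where "p2 = {(x,K) \<in> p. x \<in> E}"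
      have p12: "p = p1 \<union> p2" "p1 \<inter> p2 = {}" "p1 \<subseteq> p" "p2 \<subseteq> p" and fin12: "finite p1" "finite p2"
        using \<open>finite p\<close> by (auto simp: p1_def p2_def intro: rev_finite_subset)
      have ba: "(\<Sum>(x,K)\<in>p. Sup K - Inf K) = b - a" "(\<Sum>(x,K)\<in>p. f(Sup K) - f(Inf K)) = f b - f a"
        using additive_tagged_division_1[where f= "\<lambda>x. x"] additive_tagged_division_1[where f= f]
          \<open>a \<le> b\<close> ptag by auto
      have "(\<Sum>(x,K)\<in>p. measure lborel K *\<^sub>R h x) - (f b - f a)
            = (\<Sum>(x,K)\<in>p. measure lborel K *\<^sub>R h x - (f(Sup K) - f(Inf K)))"
        by (simp add: ba(2)[symmetric] case_prod_unfold sum_subtractf)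
      also have "norm \<dots> \<le> (\<Sum>(x,K)\<in>p. norm (measure lborel K *\<^sub>R h x - (f(Sup K) - f(Inf K))))"
        by (simp add: case_prod_unfold sum_norm_le)
      also have "\<dots> = (\<Sum>(x,K)\<in>p1. norm (measure lborel K *\<^sub>R h x - (f(Sup K) - f(Inf K))))
                    + (\<Sum>(x,K)\<in>p2. norm (measure lborel K *\<^sub>R h x - (f(Sup K) - f(Inf K))))"
        by (subst (1) p12(1), rule sum.union_disjoint) (use fin12 p12 in auto)
      also have "(\<Sum>(x,K)\<in>p1. norm (measure lborel K *\<^sub>R h x - (f(Sup K) - f(Inf K)))) 
                \<le> (\<Sum>(x,K)\<in>p1. e1 * (Sup K - Inf K))"
      proof (rule sum_mono, clarify)
        fix x K assume "(x,K) \<in> p1"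
        then have xK: "(x,K) \<in> p" and "x \<notin> E" by (auto simp: p1_def)
        then obtain u v where K: "K = {u..v}" "u \<le> v" "u \<in> {a..b}" "v \<in> {a..b}" "x \<in> {u..v}"
          using Icc by metis
        have "K \<subseteq> ball x (d x)" using fine xK by blast
        moreover have "u \<in> K" "v \<in> K" using K by auto
        ultimately have "norm (u - x) < d x" "norm (v - x) < d x"
          by (auto simp: subset_iff dist_norm norm_minus_commute)
        then have 1: "norm (f u - f x - (u-x) *\<^sub>R g x) \<le> e1 * norm (u-x)"
              "norm (f v - f x - (v-x) *\<^sub>R g x) \<le> e1 * norm (v-x)"
          using d(2)[of x u] d(2)[of x v] K \<open>x \<notin> E\<close> by auto
        have "measure lborel K *\<^sub>R h x - (f(Sup K) - f(Inf K)) = 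
             (f u - f x - (u-x) *\<^sub>R g x) - (f v - f x - (v-x) *\<^sub>R g x)"
          using K \<open>x \<notin> E\<close> by (simp add: h_def algebra_simps)
        also have "norm \<dots> \<le> e1 * norm (u-x) + e1 * norm (v-x)"
          using norm_triangle_ineq4 1 by (smt (verit))
        also have "\<dots> = e1 * (Sup K - Inf K)"
          using K by (simp add: algebra_simps)
        finally show "norm (measure lborel K *\<^sub>R h x - (f(Sup K) - f(Inf K))) \<le> e1 * (Sup K - Inf K)" .
      qed
      also have "(\<Sum>(x,K)\<in>p1. e1 * (Sup K - Inf K)) \<le> (\<Sum>(x,K)\<in>p. e1 * (Sup K - Inf K))"
        using \<open>finite p\<close> p12 \<open>e1 > 0\<close>
      proof (intro sum_mono2)
        fix q assume "q \<in> p - p1"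
        with Icc[of "fst q" "snd q"] \<open>e1 > 0\<close> show "0 \<le> (case q of (x, K) \<Rightarrow> e1 * (Sup K - Inf K))" 
          by (auto simp: case_prod_unfold)
      qed auto
      also have "\<dots> = e1 * (b - a)"
        by (simp add: ba(1)[symmetric] case_prod_unfold sum_distrib_left)
      also have "(\<Sum>(x,K)\<in>p2. norm (measure lborel K *\<^sub>R h x - (f(Sup K) - f(Inf K)))) < e/2"
      proof -
        have part: "p2 tagged_partial_division_of cbox a b"
          using ptag p12(4) by (meson tagged_division_of_def tagged_partial_division_subset)
        have td: "p2 tagged_division_of \<Union>(snd ` p2)"
          by (rule tagged_partial_division_of_Union_self[OF part])
        have Icc2: "\<exists>u v. K = {u..v} \<and> u \<le> v \<and> u \<in> {a..b} \<and> v \<in> {a..b}" if "K \<in> snd ` p2" for K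
          using that Icc p12 by fastforce
        have *: "(\<Sum>(x,K)\<in>p2. \<phi> K) = (\<Sum>K\<in>snd ` p2. \<phi> K)" if \<phi>: "\<And>u. \<phi> {u..u} = 0" for \<phi> :: "real set \<Rightarrow> real"
        proof -
          \<comment> \<open>\<open>Sup {}\<close> and \<open>Inf {}\<close> are unspecified reals, hence the guard against the empty box.\<close>
          have "(\<Sum>(x,K)\<in>p2. if K = {} then 0 else \<phi> K) = (\<Sum>K\<in>snd ` p2. if K = {} then 0 else \<phi> K)"
          proof (rule sum.over_tagged_division_lemma[OF td])
            fix u v :: real assume "box u v = {}"
            then have "v \<le> u" by simp
            then show "(if cbox u v = {} then 0 else \<phi> (cbox u v)) = 0"
              using \<phi>[of u] by (cases "u = v") auto
          qed
          moreover have "(\<Sum>(x,K)\<in>p2. if K = {} then 0 else \<phi> K) = (\<Sum>(x,K)\<in>p2. \<phi> K)"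
            using Icc2 by (intro sum.cong) fastforce+
          moreover have "(\<Sum>K\<in>snd ` p2. if K = {} then 0 else \<phi> K) = (\<Sum>K\<in>snd ` p2. \<phi> K)"
            using Icc2 by (intro sum.cong) fastforce+
          ultimately show ?thesis by simp
        qed
        have "(\<Sum>K\<in>snd ` p2. Sup K - Inf K) = (\<Sum>(x,K)\<in>p2. Sup K - Inf K)"
          by (rule *[symmetric]) simp
        also have "\<dots> = (\<Sum>(x,k)\<in>p2. norm(measure lborel k *\<^sub>R indicat_real E x - integral k (indicat_real E)))"
        proof (rule sum.cong, simp, clarify)
          fix x K assume "(x,K) \<in> p2"
          then have "x \<in> E" "(x,K) \<in> p" by (auto simp: p2_def)
          then obtain u v where K: "K = {u..v}" "u \<le> v" using Icc by metis
          have "integral K (indicat_real E) = 0"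
            using ind[of u v] K by (simp add: integral_unique)
          then show "Sup K - Inf K = norm(measure lborel K *\<^sub>R indicat_real E x - integral K (indicat_real E))"
            using K \<open>x \<in> E\<close> by simp
        qed
        also have "\<dots> < \<delta>"
          using \<gamma>[OF part] fine p12 by (meson fine_subset)
        finally have lt: "(\<Sum>K\<in>snd ` p2. Sup K - Inf K) < \<delta>" .
        have "(\<Sum>(x,K)\<in>p2. norm (measure lborel K *\<^sub>R h x - (f(Sup K) - f(Inf K))))
            = (\<Sum>(x,K)\<in>p2. norm (f(Sup K) - f(Inf K)))"
          by (rule sum.cong) (auto simp: p2_def h_def norm_minus_commute)
        also have "\<dots> = (\<Sum>K\<in>snd ` p2. norm (f(Sup K) - f(Inf K)))"
          by (rule *) simp
        also have "\<dots> < e/2"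
          using lt partial_division_of_tagged_division[OF part] Icc2 by (intro \<delta>) fastforce+
        finally show ?thesis .
      qed
      finally show "norm ((\<Sum>(x, k)\<in>p. measure lborel k *\<^sub>R h x) - (f b - f a)) < e"
        using \<open>e1 * (b - a) < e/2\<close> by linarith
    qed
  qed
  then show ?thesis
    using has_integral_spike[OF neg, of "{a..b}" g h] by (simp add: h_def)
qed

text \<open>
  Absolute continuity of the integral: truncating \<open>norm (u t)\<close> at a large \<open>n\<close> changes its integral by
  less than \<open>\<epsilon>/2\<close>, and the truncated function contributes at most \<open>n\<close> times the length.
\<close>

lemma integral_norm_small_on_small_divisions:
  fixes u :: "real \<Rightarrow> 'a::euclidean_space"
  assumes u: "u absolutely_integrable_on {a..b}" and "\<epsilon> > 0"
  obtains \<delta> where "\<delta> > 0"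
    "\<And>d. \<lbrakk>d division_of \<Union>d; \<Union>d \<subseteq> {a..b}; (\<Sum>k\<in>d. Sup k - Inf k) < \<delta>\<rbrakk>
        \<Longrightarrow> (\<Sum>k\<in>d. norm (integral k u)) < \<epsilon>"
proof -
  define m where "m n t = min (norm (u t)) (real n)" for n t
  let ?M = "lebesgue_on {a..b}"
  have meas: "u \<in> borel_measurable ?M" and int: "integrable ?M (\<lambda>t. norm (u t))"
    using u absolutely_integrable_measurable[of "{a..b}" u] by (auto simp: o_def)
  have m_int: "integrable ?M (m n)" for n
    unfolding m_def by (rule Bochner_Integration.integrable_bound[OF int]) (use meas in auto)
  have "(\<lambda>n. LINT t|?M. m n t) \<longlonglongrightarrow> (LINT t|?M. norm (u t))"
  proof (rule integral_dominated_convergence[OF _ _ int])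
    show "AE t in ?M. (\<lambda>n. m n t) \<longlonglongrightarrow> norm (u t)"
    proof (intro AE_I2 tendsto_eventually)
      fix t
      show "\<forall>\<^sub>F n in sequentially. m n t = norm (u t)"
        using eventually_ge_at_top[of "nat \<lceil>norm (u t)\<rceil>"]
        by eventually_elim (auto simp: m_def min_def nat_le_iff ceiling_le_iff)
    qed
  qed (use meas in \<open>auto simp: m_def\<close>)
  then have "\<forall>\<^sub>F n in sequentially. (LINT t|?M. m n t) > (LINT t|?M. norm (u t)) - \<epsilon>/2"
    by (rule order_tendstoD(1)) (use \<open>\<epsilon> > 0\<close> in simp)
  then obtain n where n: "(LINT t|?M. m n t) > (LINT t|?M. norm (u t)) - \<epsilon>/2"
    by (meson eventually_sequentially le_refl)
  define r where "r t = norm (u t) - m n t" for t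
  have iu: "u integrable_on {a..b}" and inu: "(\<lambda>t. norm (u t)) integrable_on {a..b}"
    using u by (auto simp: absolutely_integrable_on_def)
  have im: "m n integrable_on {a..b}"
    by (rule integrable_on_lebesgue_on[OF m_int]) simp
  have ir: "r integrable_on {a..b}" unfolding r_def by (rule integrable_diff[OF inu im])
  have r0: "r t \<ge> 0" for t by (simp add: r_def m_def)
  have r_small: "integral {a..b} r < \<epsilon>/2"
    using n lebesgue_integral_eq_integral[OF m_int[of n]] lebesgue_integral_eq_integral[OF int]
      Henstock_Kurzweil_Integration.integral_diff[OF inu im] by (simp add: r_def[abs_def])
  show ?thesis
  proof (rule that[of "\<epsilon> / (2 * (real n + 1))"])
    show "\<epsilon> / (2 * (real n + 1)) > 0" using \<open>\<epsilon> > 0\<close> by simp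
    fix d assume d: "d division_of \<Union>d" "\<Union>d \<subseteq> {a..b}" 
      and small: "(\<Sum>k\<in>d. Sup k - Inf k) < \<epsilon> / (2 * (real n + 1))"
    have "norm (integral k u) \<le> integral k r + real n * (Sup k - Inf k)" if "k \<in> d" for k
    proof -
      obtain x y where k: "k = {x..y}" "x \<le> y"
        using division_ofD(3,4)[OF d(1) \<open>k \<in> d\<close>] by auto
      have sub: "{x..y} \<subseteq> {a..b}" using k that d(2) by blast
      have I: "h integrable_on {x..y}" if "h integrable_on {a..b}" for h :: "real \<Rightarrow> 'c::banach"
        by (rule integrable_on_subinterval[OF that sub])
      have "norm (integral {x..y} u) \<le> integral {x..y} (\<lambda>t. norm (u t))"
        by (rule integral_norm_bound_integral) (use I iu inu in auto)
      also have "\<dots> = integral {x..y} r + integral {x..y} (m n)"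
        using I[OF inu] I[OF im] by (simp add: r_def[abs_def] Henstock_Kurzweil_Integration.integral_diff)
      also have "integral {x..y} (m n) \<le> integral {x..y} (\<lambda>t. real n)"
        by (rule integral_le) (use I[OF im] in \<open>auto simp: m_def\<close>)
      finally show ?thesis using k by (simp add: algebra_simps)
    qed
    then have "(\<Sum>k\<in>d. norm (integral k u)) \<le> (\<Sum>k\<in>d. integral k r) + real n * (\<Sum>k\<in>d. Sup k - Inf k)"
      by (simp add: sum_distrib_left flip: sum.distrib) (meson sum_mono)
    also have "(\<Sum>k\<in>d. integral k r) \<le> integral {a..b} r"
    proof -
      have h: "(r has_integral (\<Sum>k\<in>d. integral k r)) (\<Union>d)"
        by (rule has_integral_combine_division_topdown[OF ir d])
      then have "(\<Sum>k\<in>d. integral k r) = integral (\<Union>d) r" by (simp add: integral_unique)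
      also have "\<dots> \<le> integral {a..b} r"
        by (rule integral_subset_le) (use d(2) h ir r0 in auto)
      finally show ?thesis .
    qed
    also have "real n * (\<Sum>k\<in>d. Sup k - Inf k) \<le> real n * (\<epsilon> / (2 * (real n + 1)))"
      using small by (intro mult_left_mono) auto
    also have "\<dots> \<le> \<epsilon>/2" using \<open>\<epsilon> > 0\<close> by (simp add: field_simps)
    finally show "(\<Sum>k\<in>d. norm (integral k u)) < \<epsilon>" using r_small by linarith
  qed
qed

lemma abs_continuous_on_indefinite_integral:
  fixes u :: "real \<Rightarrow> 'a::euclidean_space"
  assumes u: "u absolutely_integrable_on {a..b}"
  shows "abs_continuous_on {a..b} (\<lambda>t. integral {a..t} u)"
  unfolding abs_continuous_on_def
proof (intro allI impI)
  fix \<epsilon> :: real assume "\<epsilon> > 0"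
  obtain \<delta> where \<delta>: "\<delta> > 0" 
    "\<And>d. \<lbrakk>d division_of \<Union>d; \<Union>d \<subseteq> {a..b}; (\<Sum>k\<in>d. Sup k - Inf k) < \<delta>\<rbrakk>
        \<Longrightarrow> (\<Sum>k\<in>d. norm (integral k u)) < \<epsilon>"
    using integral_norm_small_on_small_divisions[OF u \<open>\<epsilon> > 0\<close>] by blast
  have eq: "integral {a..Sup k} u - integral {a..Inf k} u = integral k u"
    if d: "d division_of \<Union>d" "\<Union>d \<subseteq> {a..b}" "k \<in> d" for d and k :: "real set"
  proof -
    obtain x y where k: "k = {x..y}" "x \<le> y"
      using division_ofD(3,4)[OF d(1) d(3)] by auto
    have sub: "a \<le> x" "y \<le> b" using k d by fastforce+
    have "u integrable_on {a..y}"
      using u sub by (auto simp: absolutely_integrable_on_def intro: integrable_on_subinterval)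
    then show ?thesis
      using Henstock_Kurzweil_Integration.integral_combine[where f=u and a=a and c=x and b=y] sub k by (simp add: algebra_simps)
  qed
  show "\<exists>\<delta>>0. \<forall>d. d division_of \<Union> d \<and> \<Union> d \<subseteq> {a..b} \<and> (\<Sum>k\<in>d. Sup k - Inf k) < \<delta> \<longrightarrow>
            (\<Sum>k\<in>d. norm (integral {a..Sup k} u - integral {a..Inf k} u)) < \<epsilon>"
    using \<delta> eq by (intro exI[of _ \<delta>]) (auto cong: sum.cong)
qed

lemma integral_averages_converge_right:
  fixes u :: "real \<Rightarrow> 'a::euclidean_space"
  assumes u: "\<And>a b. u integrable_on {a..b}"
  obtains N where "negligible N"
    "\<And>x e. \<lbrakk>x \<notin> N; 0 < e\<rbrakk> \<Longrightarrow>
       \<exists>d>0. \<forall>y. x < y \<and> y < x + d \<longrightarrow> norm (integral {x..y} u - (y - x) *\<^sub>R u x) \<le> e * (y - x)"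
proof -
  obtain N where N: "negligible N"
       "\<And>x e. \<lbrakk>x \<notin> N; 0 < e\<rbrakk> \<Longrightarrow>
               \<exists>d>0. \<forall>h. 0 < h \<and> h < d \<longrightarrow>
                         norm(integral (cbox x (x + h *\<^sub>R One)) u /\<^sub>R h ^ DIM(real) - u x) < e"
    using integrable_ccontinuous_explicit[of u] u by (metis box_real(2))
  show ?thesis
  proof (rule that[OF N(1)])
    fix x e :: real assume "x \<notin> N" "0 < e"
    then obtain d where "d > 0" and d: "\<And>h. \<lbrakk>0 < h; h < d\<rbrakk> \<Longrightarrow> norm(integral {x..x + h} u /\<^sub>R h - u x) < e"
      using N(2)[of x e] by (auto simp: cbox_interval)
    have "norm (integral {x..y} u - (y - x) *\<^sub>R u x) \<le> e * (y - x)" if "x < y" "y < x + d" for y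
    proof -
      have "integral {x..y} u - (y - x) *\<^sub>R u x = (y - x) *\<^sub>R (integral {x..x + (y-x)} u /\<^sub>R (y-x) - u x)"
        using that by (simp add: scaleR_diff_right)
      also have "norm \<dots> \<le> (y - x) * e"
        using d[of "y - x"] that by (simp add: mult_left_mono)
      finally show ?thesis by (simp add: mult.commute)
    qed
    then show "\<exists>d>0. \<forall>y. x < y \<and> y < x + d \<longrightarrow> norm (integral {x..y} u - (y - x) *\<^sub>R u x) \<le> e * (y - x)"
      using \<open>d > 0\<close> by blast
  qed
qed

text \<open>
  The left difference quotients of the primitive of \<open>u\<close> at \<open>x\<close> are the right ones of the primitive of
  \<open>\<lambda>t. u (- t)\<close> at \<open>- x\<close>, so the one-sided differentiation theorem, applied to both functions,
  yields the two-sided derivative.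
\<close>

lemma indefinite_integral_has_vector_derivative_AE:
  fixes u :: "real \<Rightarrow> 'a::euclidean_space"
  assumes u: "u integrable_on {a..b}"
  obtains N where "negligible N"
    "\<And>x. \<lbrakk>x \<in> {a..b}; x \<notin> N\<rbrakk> \<Longrightarrow>
       ((\<lambda>t. integral {a..t} u) has_vector_derivative u x) (at x within {a..b})"
proof -
  define h where "h t = (if t \<in> {a..b} then u t else 0)" for t
  have "h integrable_on UNIV" unfolding h_def using u by (simp only: integrable_restrict_UNIV)
  then have ih: "h integrable_on {c..d}" for c d
    by (rule integrable_on_subinterval) simp
  have ih': "(\<lambda>t. h (- t)) integrable_on {c..d}" for c d
    using ih[of "-d" "-c"] Henstock_Kurzweil_Integration.integrable_reflect_real[where f=h and a="-d" and b="-c"] by simp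
  obtain N1 where N1: "negligible N1" "\<And>x e. \<lbrakk>x \<notin> N1; 0 < e\<rbrakk> \<Longrightarrow>
       \<exists>d>0. \<forall>y. x < y \<and> y < x + d \<longrightarrow> norm (integral {x..y} h - (y - x) *\<^sub>R h x) \<le> e * (y - x)"
    using integral_averages_converge_right[OF ih] by blast
  obtain N2 where N2: "negligible N2" "\<And>x e. \<lbrakk>x \<notin> N2; 0 < e\<rbrakk> \<Longrightarrow>
       \<exists>d>0. \<forall>y. x < y \<and> y < x + d \<longrightarrow> norm (integral {x..y} (\<lambda>t. h (- t)) - (y - x) *\<^sub>R h (- x)) \<le> e * (y - x)"
    using integral_averages_converge_right[OF ih'] by blast
  have F: "integral {a..t} u = integral {a..t} h" if "t \<in> {a..b}" for t
    using that by (intro integral_cong) (auto simp: h_def)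
  show ?thesis
  proof (rule that[of "N1 \<union> uminus ` N2"])
    show "negligible (N1 \<union> uminus ` N2)"
      using N1(1) N2(1)
      by (intro negligible_Un negligible_differentiable_image_negligible)
        (auto intro!: derivative_intros differentiable_on_minus differentiable_on_ident)
    fix x assume x: "x \<in> {a..b}" "x \<notin> N1 \<union> uminus ` N2"
    then have "- x \<notin> N2" by (force simp: image_iff)
    show "((\<lambda>t. integral {a..t} u) has_vector_derivative u x) (at x within {a..b})"
      unfolding has_vector_derivative_def has_derivative_within_alt
    proof (intro conjI allI impI)
      show "bounded_linear (\<lambda>t. t *\<^sub>R u x)" by (rule bounded_linear_scaleR_left)
      fix e :: real assume "e > 0"
      obtain d1 where "d1 > 0" and d1: "\<And>y. \<lbrakk>x < y; y < x + d1\<rbrakk> \<Longrightarrow> norm (integral {x..y} h - (y - x) *\<^sub>R h x) \<le> e * (y - x)"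
        using N1(2)[of x e] x \<open>e > 0\<close> by auto
      obtain d2 where "d2 > 0" and d2: "\<And>y. \<lbrakk>- x < y; y < - x + d2\<rbrakk> \<Longrightarrow> norm (integral {-x..y} (\<lambda>t. h (-t)) - (y + x) *\<^sub>R h x) \<le> e * (y + x)"
        using N2(2)[of "-x" e] \<open>- x \<notin> N2\<close> \<open>e > 0\<close> by auto
      have hx: "h x = u x" using x by (simp add: h_def)
      have "norm (integral {a..y} u - integral {a..x} u - (y - x) *\<^sub>R u x) \<le> e * norm (y - x)"
        if y: "y \<in> {a..b}" "norm (y - x) < min d1 d2" for y
      proof (cases y x rule: linorder_cases)
        case less
        have "integral {a..x} h = integral {a..y} h + integral {y..x} h"
          using less y x by (intro Henstock_Kurzweil_Integration.integral_combine[symmetric] ih) auto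
        moreover have "integral {-x..-y} (\<lambda>t. h (- t)) = integral {y..x} h"
          by (rule Henstock_Kurzweil_Integration.integral_reflect_real)
        moreover have "norm (integral {-x..-y} (\<lambda>t. h (-t)) - (- y + x) *\<^sub>R h x) \<le> e * (- y + x)"
          using less y by (intro d2) auto
        ultimately show ?thesis
          using less x y hx by (simp add: F algebra_simps norm_minus_commute)
      next
        case greater
        have "integral {a..y} h = integral {a..x} h + integral {x..y} h"
          using greater y x by (intro Henstock_Kurzweil_Integration.integral_combine[symmetric] ih) auto
        moreover have "norm (integral {x..y} h - (y - x) *\<^sub>R h x) \<le> e * (y - x)"
          using greater y by (intro d1) auto
        ultimately show ?thesis
          using greater x y hx by (simp add: F algebra_simps)
      qed simp
      then show "\<exists>d>0. \<forall>y\<in>{a..b}. norm (y - x) < d \<longrightarrow>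
                norm (integral {a..y} u - integral {a..x} u - (y - x) *\<^sub>R u x) \<le> e * norm (y - x)"
        using \<open>d1 > 0\<close> \<open>d2 > 0\<close> by (intro exI[of _ "min d1 d2"]) auto
    qed
  qed
qed

section \<open>The curve of a control\<close>

lemma AE_lebesgue_on_iff_negligible:
  assumes "S \<in> sets lebesgue"
  shows "(AE x in lebesgue_on S. P x) \<longleftrightarrow> (\<exists>E. negligible E \<and> (\<forall>x\<in>S - E. P x))"
proof -
  have "(AE x in lebesgue_on S. P x) \<longleftrightarrow> (AE x in lebesgue. x \<in> S \<longrightarrow> P x)"
    using assms by (simp add: AE_restrict_space_iff)
  also have "\<dots> \<longleftrightarrow> (\<exists>N\<in>null_sets lebesgue. {x. \<not> (x \<in> S \<longrightarrow> P x)} \<subseteq> N)"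
    by (simp add: eventually_ae_filter)
  also have "\<dots> \<longleftrightarrow> (\<exists>E. negligible E \<and> (\<forall>x\<in>S - E. P x))"
    unfolding negligible_iff_null_sets by blast
  finally show ?thesis .
qed

lemma abs_continuous_on_subset:
  assumes "abs_continuous_on S f" "T \<subseteq> S"
  shows "abs_continuous_on T f"
  using assms unfolding abs_continuous_on_def by (meson order_trans)

lemma abs_continuous_on_cong:
  assumes "\<And>t. t \<in> S \<Longrightarrow> f t = g t"
  shows "abs_continuous_on S f \<longleftrightarrow> abs_continuous_on S g"
proof -
  have "f (Sup k) = g (Sup k) \<and> f (Inf k) = g (Inf k)"
    if d: "d division_of \<Union>d" "\<Union>d \<subseteq> S" "k \<in> d" for d k
  proof -
    obtain x y where k: "k = {x..y}" "x \<le> y"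
      using division_ofD(3,4)[OF d(1) d(3)] by auto
    then have "x \<in> k" "y \<in> k" by auto
    then have "x \<in> S" "y \<in> S" using d by blast+
    then show ?thesis using assms k by auto
  qed
  then have "(\<Sum>k\<in>d. norm (f (Sup k) - f (Inf k))) = (\<Sum>k\<in>d. norm (g (Sup k) - g (Inf k)))"
    if "d division_of \<Union>d" "\<Union>d \<subseteq> S" for d
    using that by (intro sum.cong) auto
  then show ?thesis
    unfolding abs_continuous_on_def by simp
qed

lemma abs_continuous_on_bounded_linear:
  fixes f :: "real \<Rightarrow> 'a::euclidean_space" and h :: "'a \<Rightarrow> 'b::euclidean_space"
  assumes f: "abs_continuous_on S f" and h: "bounded_linear h"
  shows "abs_continuous_on S (\<lambda>t. h (f t))"
  unfolding abs_continuous_on_def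
proof (intro allI impI)
  fix \<epsilon> :: real assume "\<epsilon> > 0"
  obtain K where "K > 0" and K: "\<And>x. norm (h x) \<le> norm x * K"
    using bounded_linear.pos_bounded[OF h] by blast
  obtain \<delta> where "\<delta> > 0" and \<delta>: "\<And>d. \<lbrakk>d division_of \<Union>d; \<Union>d \<subseteq> S; (\<Sum>k\<in>d. Sup k - Inf k) < \<delta>\<rbrakk>
        \<Longrightarrow> (\<Sum>k\<in>d. norm (f (Sup k) - f (Inf k))) < \<epsilon> / K"
    using f[unfolded abs_continuous_on_def, rule_format, of "\<epsilon> / K"] \<open>\<epsilon> > 0\<close> \<open>K > 0\<close> by auto
  have "(\<Sum>k\<in>d. norm (h (f (Sup k)) - h (f (Inf k)))) < \<epsilon>"
    if d: "d division_of \<Union>d" "\<Union>d \<subseteq> S" "(\<Sum>k\<in>d. Sup k - Inf k) < \<delta>" for d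
  proof -
    have "(\<Sum>k\<in>d. norm (h (f (Sup k)) - h (f (Inf k)))) \<le> (\<Sum>k\<in>d. norm (f (Sup k) - f (Inf k)) * K)"
      using K by (intro sum_mono) (simp flip: linear_diff[OF bounded_linear.linear[OF h]])
    also have "\<dots> < \<epsilon>"
      using \<delta>[OF d] \<open>K > 0\<close> by (simp add: pos_less_divide_eq flip: sum_distrib_right)
    finally show ?thesis .
  qed
  then show "\<exists>\<delta>>0. \<forall>d. d division_of \<Union>d \<and> \<Union>d \<subseteq> S \<and> (\<Sum>k\<in>d. Sup k - Inf k) < \<delta> \<longrightarrow>
        (\<Sum>k\<in>d. norm (h (f (Sup k)) - h (f (Inf k)))) < \<epsilon>"
    using \<open>\<delta> > 0\<close> by blast
qed

lemma
  assumes "two_step_nilpotent br"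
  shows two_step_bilinear: "bilinear br"
    and two_step_skew: "br x y = - br y x"
    and two_step_central: "z \<in> derived_algebra br \<Longrightarrow> br x z = 0"
    and two_step_central': "z \<in> derived_algebra br \<Longrightarrow> br z x = 0"
    and bracket_in_derived: "br x y \<in> derived_algebra br"
proof -
  show bil: "bilinear br"
    using assms by (simp add: two_step_nilpotent_def lie_algebra_def)
  have self: "br x x = 0" for x
    using assms by (auto simp: two_step_nilpotent_def lie_algebra_def)
  show skew: "br x y = - br y x" for x y
  proof -
    have "br (x + y) (x + y) = br x y + br y x"
      using self[of x] self[of y] by (simp add: bilinear_ladd[OF bil] bilinear_radd[OF bil])
    then show ?thesis using self[of "x + y"] by (simp add: eq_neg_iff_add_eq_0)
  qed
  show c: "br x z = 0" if "z \<in> derived_algebra br" for x z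
  proof -
    have "br x z \<in> bracket_span br UNIV (derived_algebra br)"
      unfolding bracket_span_def using that by (intro span_base) auto
    then show ?thesis using assms by (auto simp: two_step_nilpotent_def)
  qed
  show "br z x = 0" if "z \<in> derived_algebra br" for x z
    using c[OF that] skew[of z x] by simp
  show "br x y \<in> derived_algebra br"
    unfolding derived_algebra_def bracket_span_def by (intro span_base) auto
qed

lemma dL_at_0:
  assumes "bilinear br"
  shows "dL br p 0 w = w + (1/2) *\<^sub>R br p w"
proof -
  have "bounded_linear (br p)"
    using assms by (simp add: bilinear_def linear_conv_bounded_linear)
  then have "(group_mult br p has_derivative (\<lambda>w. w + (1/2) *\<^sub>R br p w)) (at 0)"
    unfolding group_mult_def
    by (auto intro!: derivative_eq_intros bounded_linear.has_derivative[of "br p"])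
  then show ?thesis
    unfolding dL_def using frechet_derivative_at by metis
qed

lemma absolutely_integrable_bilinear_continuous:
  fixes h :: "'a::euclidean_space \<Rightarrow> 'b::euclidean_space \<Rightarrow> 'c::euclidean_space"
  assumes h: "bilinear h" and f: "continuous_on {a..b} f" and u: "u absolutely_integrable_on {a..b::real}"
  shows "(\<lambda>t. h (f t) (u t)) absolutely_integrable_on {a..b}"
proof (rule absolutely_integrable_bounded_measurable_product[OF h _ _ _ u])
  show "f \<in> borel_measurable (lebesgue_on {a..b})"
    using f by (intro continuous_imp_measurable_on_sets_lebesgue) auto
  show "bounded (f ` {a..b})"
    using f by (intro compact_imp_bounded compact_continuous_image) auto
qed simp

text \<open>
  The velocity of \<open>\<gamma>\<^sub>u\<close> is \<open>u + 1/2 [\<gamma>\<^sub>u, u]\<close>; here \<open>\<gamma>\<^sub>u\<close> is replaced by the primitive of \<open>u\<close>, from which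
  it differs by a central element.
\<close>

definition lift_velocity :: "('g::euclidean_space \<Rightarrow> 'g \<Rightarrow> 'g) \<Rightarrow> (real \<Rightarrow> 'g) \<Rightarrow> real \<Rightarrow> 'g" where
  "lift_velocity br u t = u t + (1/2) *\<^sub>R br (integral {0..t} u) (u t)"

lemma absolutely_integrable_lift_velocity:
  assumes "bilinear br" and u: "u absolutely_integrable_on {0..1}"
  shows "(\<lambda>t. br (integral {0..t} u) (u t)) absolutely_integrable_on {0..1}"
    and "lift_velocity br u absolutely_integrable_on {0..1}"
proof -
  have "continuous_on {0..1} (\<lambda>t. integral {0..t} u)"
    using u by (intro indefinite_integral_continuous_1) (auto simp: absolutely_integrable_on_def)
  then show 1: "(\<lambda>t. br (integral {0..t} u) (u t)) absolutely_integrable_on {0..1}"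
    using assms absolutely_integrable_bilinear_continuous by blast
  show "lift_velocity br u absolutely_integrable_on {0..1}"
    unfolding lift_velocity_def using set_integral_add(1)[OF u absolutely_integrable_on_scaleR_iff[THEN iffD2, OF disjI2, OF 1]] .
qed

lemma is_curve_of_integral_lift_velocity:
  fixes br :: "'g::euclidean_space \<Rightarrow> 'g \<Rightarrow> 'g"
  assumes nil: "two_step_nilpotent br" and u: "u absolutely_integrable_on {0..1}"
    and \<gamma>: "\<And>t. t \<in> {0..1} \<Longrightarrow> \<gamma> t = integral {0..t} (lift_velocity br u)"
  shows "is_curve_of br u \<gamma>"
proof -
  note bil = two_step_bilinear[OF nil]
  note ai = absolutely_integrable_lift_velocity[OF bil u]
  have sub: "f integrable_on {0..t}" if "f absolutely_integrable_on {0..1}" "t \<in> {0..1}"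
    for f :: "real \<Rightarrow> 'g" and t
    using that by (auto simp: absolutely_integrable_on_def intro: integrable_on_subinterval)
  obtain N where N: "negligible N" 
    "\<And>t. \<lbrakk>t \<in> {0..1}; t \<notin> N\<rbrakk> \<Longrightarrow>
       ((\<lambda>t. integral {0..t} (lift_velocity br u)) has_vector_derivative lift_velocity br u t) (at t within {0..1})"
    using indefinite_integral_has_vector_derivative_AE[of "lift_velocity br u" 0 1] ai(2) 
    by (auto simp: absolutely_integrable_on_def)
  have vel: "lift_velocity br u t = dL br (\<gamma> t) 0 (u t)" if t: "t \<in> {0..1}" for t
  proof -
    define Z where "Z = integral {0..t} (\<lambda>s. br (integral {0..s} u) (u s))"
    have "\<gamma> t = integral {0..t} u + (1/2) *\<^sub>R Z"
      using sub[OF u t] sub[OF ai(1) t]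
      by (simp add: \<gamma>[OF t] lift_velocity_def[abs_def] Z_def Henstock_Kurzweil_Integration.integral_add
          integrable_cmul)
    moreover have "br Z (u t) = 0"
    proof -
      have "bounded_linear (\<lambda>z. br z (u t))"
        using bil by (simp add: bilinear_def linear_conv_bounded_linear)
      then have "br Z (u t) = integral {0..t} (\<lambda>s. br (br (integral {0..s} u) (u s)) (u t))"
        unfolding Z_def using integral_linear[OF sub[OF ai(1) t] \<open>bounded_linear (\<lambda>z. br z (u t))\<close>] by (simp add: o_def)
      then show ?thesis
        using two_step_central'[OF nil bracket_in_derived[OF nil]] by simp
    qed
    ultimately show ?thesis
      by (simp add: dL_at_0[OF bil] lift_velocity_def bilinear_ladd[OF bil] bilinear_lmul[OF bil])
  qed
  have "(\<gamma> has_vector_derivative dL br (\<gamma> t) 0 (u t)) (at t within {0..1})"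
    if "t \<in> {0..1}" "t \<notin> N" for t
    using has_vector_derivative_transform[OF that(1) _ N(2)[OF that]] \<gamma> vel[OF that(1)] by simp
  then have "AE t in lebesgue_on {0..1}. (\<gamma> has_vector_derivative dL br (\<gamma> t) 0 (u t)) (at t within {0..1})"
    using N(1) by (subst AE_lebesgue_on_iff_negligible) auto
  moreover have "abs_continuous_on {0..1} \<gamma>"
    using abs_continuous_on_cong[of "{0..1}" \<gamma>, OF \<gamma>] abs_continuous_on_indefinite_integral[OF ai(2)] by blast
  moreover have "\<gamma> 0 = 0" using \<gamma>[of 0] by simp
  ultimately show ?thesis by (simp add: is_curve_of_def)
qed

text \<open>
  Bracketing the differential equation with a fixed \<open>y\<close> removes its nonlinear part, which is central.
  This determines \<open>[\<gamma>, y]\<close> first, and with it the whole right-hand side.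
\<close>

lemma is_curve_of_unique:
  assumes nil: "two_step_nilpotent br" and u: "u absolutely_integrable_on {0..1}"
    and \<gamma>: "is_curve_of br u \<gamma>" and t: "t \<in> {0..1}"
  shows "\<gamma> t = integral {0..t} (lift_velocity br u)"
proof -
  note bil = two_step_bilinear[OF nil]
  obtain E where E: "negligible E" "\<And>s. \<lbrakk>s \<in> {0..1}; s \<notin> E\<rbrakk> \<Longrightarrow> 
       (\<gamma> has_vector_derivative u s + (1/2) *\<^sub>R br (\<gamma> s) (u s)) (at s within {0..1})"
    using \<gamma> by (auto simp: is_curve_of_def AE_lebesgue_on_iff_negligible dL_at_0[OF bil])
  have ac: "abs_continuous_on {0..1} \<gamma>" and "\<gamma> 0 = 0" using \<gamma> by (auto simp: is_curve_of_def)
  have der: "(\<gamma> has_vector_derivative u s + (1/2) *\<^sub>R br (\<gamma> s) (u s)) (at s within {0..t'})"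
    if "s \<in> {0..t'}" "s \<notin> E" "t' \<in> {0..1}" for s t'
    using E(2)[of s] that by (auto intro: has_vector_derivative_within_subset)
  have br: "br (\<gamma> s) y = br (integral {0..s} u) y" if s: "s \<in> {0..1}" for s y
  proof -
    have lin: "bounded_linear (\<lambda>z. br z y)"
      using bil by (simp add: bilinear_def linear_conv_bounded_linear)
    have "((\<lambda>r. br (u r) y) has_integral br (\<gamma> s) y - br (\<gamma> 0) y) {0..s}"
    proof (rule abs_continuous_on_has_integral[OF _ _ E(1)])
      show "abs_continuous_on {0..s} (\<lambda>r. br (\<gamma> r) y)"
        using s by (intro abs_continuous_on_subset[OF abs_continuous_on_bounded_linear[OF ac lin]]) auto
      fix r assume r: "r \<in> {0..s}" "r \<notin> E"
      have "((\<lambda>r. br (\<gamma> r) y) has_vector_derivative br (u r + (1/2) *\<^sub>R br (\<gamma> r) (u r)) y) (at r within {0..s})"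
        using der[OF r s] by (rule bounded_linear.has_vector_derivative[OF lin])
      then show "((\<lambda>r. br (\<gamma> r) y) has_vector_derivative br (u r) y) (at r within {0..s})"
        using two_step_central'[OF nil bracket_in_derived[OF nil]]
        by (simp add: bilinear_ladd[OF bil] bilinear_lmul[OF bil])
    qed (use s in auto)
    moreover have "u integrable_on {0..s}"
      using u s by (auto simp: absolutely_integrable_on_def intro: integrable_on_subinterval)
    then have "((\<lambda>r. br (u r) y) has_integral br (integral {0..s} u) y) {0..s}"
      using has_integral_linear[OF integrable_integral lin, of u "{0..s}"] unfolding o_def by blast
    ultimately show ?thesis
      unfolding \<open>\<gamma> 0 = 0\<close> bilinear_lzero[OF bil] diff_zero by (rule has_integral_unique)
  qed
  have "(lift_velocity br u has_integral \<gamma> t - \<gamma> 0) {0..t}"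
  proof (rule abs_continuous_on_has_integral[OF _ _ E(1)])
    show "abs_continuous_on {0..t} \<gamma>"
      using t by (intro abs_continuous_on_subset[OF ac]) auto
    fix r assume r: "r \<in> {0..t}" "r \<notin> E"
    then show "(\<gamma> has_vector_derivative lift_velocity br u r) (at r within {0..t})"
      using der[OF r t] br[of r "u r"] t by (simp add: lift_velocity_def)
  qed (use t in auto)
  then show ?thesis using \<open>\<gamma> 0 = 0\<close> by (simp add: integral_unique)
qed

lemma curve_of_endpoint:
  assumes nil: "two_step_nilpotent br" and u: "u absolutely_integrable_on {0..1}"
  shows "curve_of br u 1 = integral {0..1} u + (1/2) *\<^sub>R integral {0..1} (\<lambda>t. br (integral {0..t} u) (u t))"
proof -
  define \<Gamma> where "\<Gamma> = restrict (\<lambda>t. integral {0..t} (lift_velocity br u)) {0..1}"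
  have "curve_of br u = \<Gamma>"
    unfolding curve_of_def
  proof (rule the_equality)
    show "\<Gamma> \<in> extensional {0..1} \<and> is_curve_of br u \<Gamma>"
      using is_curve_of_integral_lift_velocity[OF nil u, of \<Gamma>] by (simp add: \<Gamma>_def)
    fix \<gamma> assume "\<gamma> \<in> extensional {0..1} \<and> is_curve_of br u \<gamma>"
    then show "\<gamma> = \<Gamma>"
      using is_curve_of_unique[OF nil u] by (intro extensionalityI[of _ "{0..1}"]) (auto simp: \<Gamma>_def)
  qed
  then show ?thesis
    using absolutely_integrable_lift_velocity(1)[OF two_step_bilinear[OF nil] u] u
    by (simp add: \<Gamma>_def lift_velocity_def[abs_def] absolutely_integrable_on_def
        Henstock_Kurzweil_Integration.integral_add integrable_cmul)
qed

text \<open>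
  The three summands of the perturbed endpoint are of degree 0, 1 and 2 in \<open>v\<close>.
\<close>

lemma curve_of_add_endpoint:
  fixes v :: "real \<Rightarrow> 'g::euclidean_space"
  assumes nil: "two_step_nilpotent br" and u: "u absolutely_integrable_on {0..1}"
    and v: "continuous_on {0..1} v" and closed: "integral {0..1} v = 0"
  shows "curve_of br (\<lambda>t. u t + v t) 1 = curve_of br u 1
     + (1/2) *\<^sub>R integral {0..1} (\<lambda>t. br (integral {0..t} u) (v t) + br (integral {0..t} v) (u t))
     + (1/2) *\<^sub>R integral {0..1} (\<lambda>t. br (integral {0..t} v) (v t))"
proof -
  note bil = two_step_bilinear[OF nil]
  have vi: "v absolutely_integrable_on {0..1}"
    using v by (rule absolutely_integrable_continuous_real)
  have uv: "(\<lambda>t. u t + v t) absolutely_integrable_on {0..1}"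
    using set_integral_add(1)[OF u vi] .
  have cont: "continuous_on {0..1} (\<lambda>t. integral {0..t} w)" if "w absolutely_integrable_on {0..1}" for w :: "real \<Rightarrow> 'g"
    using that by (intro indefinite_integral_continuous_1) (auto simp: absolutely_integrable_on_def)
  have I: "(\<lambda>t. br (integral {0..t} w) (z t)) integrable_on {0..1}"
    if "w absolutely_integrable_on {0..1}" "z absolutely_integrable_on {0..1}" for w z :: "real \<Rightarrow> 'g"
    using absolutely_integrable_bilinear_continuous[OF bil cont[OF that(1)] that(2)]
    by (simp add: absolutely_integrable_on_def)
  have sub: "w integrable_on {0..t}" if "w absolutely_integrable_on {0..1}" "t \<in> {0..1}" for w :: "real \<Rightarrow> 'g" and t
    using that by (auto simp: absolutely_integrable_on_def intro: integrable_on_subinterval)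
  have "integral {0..1} (\<lambda>t. br (integral {0..t} (\<lambda>t. u t + v t)) (u t + v t))
     = integral {0..1} (\<lambda>t. br (integral {0..t} u) (u t) + 
         (br (integral {0..t} u) (v t) + br (integral {0..t} v) (u t)) + br (integral {0..t} v) (v t))"
    by (intro integral_cong)
      (simp add: Henstock_Kurzweil_Integration.integral_add sub[OF u] sub[OF vi] bilinear_ladd[OF bil] bilinear_radd[OF bil])
  also have "\<dots> = integral {0..1} (\<lambda>t. br (integral {0..t} u) (u t)) +
         integral {0..1} (\<lambda>t. br (integral {0..t} u) (v t) + br (integral {0..t} v) (u t)) + 
         integral {0..1} (\<lambda>t. br (integral {0..t} v) (v t))"
    by (simp add: Henstock_Kurzweil_Integration.integral_add I u vi integrable_add)
  finally have *: "integral {0..1} (\<lambda>t. br (integral {0..t} (\<lambda>t. u t + v t)) (u t + v t)) = \<dots>" .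
  show ?thesis
    unfolding curve_of_endpoint[OF nil uv] curve_of_endpoint[OF nil u] *
    using closed sub[OF u, of 1] sub[OF vi, of 1]
    by (simp add: Henstock_Kurzweil_Integration.integral_add scaleR_add_right)
qed

section \<open>Trigonometric loops\<close>

lemma cos_integral_period:
  "((\<lambda>t. cos (2 * pi * of_int k * t)) has_integral (if k = 0 then 1 else 0)) {0..1::real}"
proof (cases "k = 0")
  case True
  then show ?thesis using has_integral_const_real[of "1::real" 0 1] by simp
next
  case False
  define w where "w = 2 * pi * of_int k"
  have "w \<noteq> 0" using False by (simp add: w_def)
  have "((\<lambda>t. cos (w * t)) has_integral (sin (w * 1) / w - sin (w * 0) / w)) {0..1}"
    using \<open>w \<noteq> 0\<close>
    by (intro fundamental_theorem_of_calculus)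
      (auto intro!: derivative_eq_intros simp flip: has_real_derivative_iff_has_vector_derivative)
  moreover have "sin w = 0"
    unfolding w_def using sin_int_2pin by (metis mult.assoc mult.commute)
  ultimately show ?thesis using False by (simp add: w_def)
qed

lemma sin_integral_period:
  "((\<lambda>t. sin (2 * pi * of_int k * t)) has_integral 0) {0..1::real}"
proof (cases "k = 0")
  case False
  define w where "w = 2 * pi * of_int k"
  have "w \<noteq> 0" using False by (simp add: w_def)
  have "((\<lambda>t. sin (w * t)) has_integral (- cos (w * 1) / w - - cos (w * 0) / w)) {0..1}"
    using \<open>w \<noteq> 0\<close>
    by (intro fundamental_theorem_of_calculus)
      (auto intro!: derivative_eq_intros simp flip: has_real_derivative_iff_has_vector_derivative)
  moreover have "cos w = 1"
    unfolding w_def using cos_int_2pin by (metis mult.assoc mult.commute)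
  ultimately show ?thesis using False by (simp add: w_def)
qed simp

definition loop :: "nat \<Rightarrow> 'a::real_vector \<Rightarrow> 'a \<Rightarrow> real \<Rightarrow> 'a" where
  "loop q x y t = cos (2 * pi * real q * t) *\<^sub>R x + sin (2 * pi * real q * t) *\<^sub>R y"

lemma continuous_on_loop: "continuous_on S (loop q x (y :: 'a::real_normed_vector))"
  unfolding loop_def by (intro continuous_intros)

lemma loop_in_subspace: "\<lbrakk>subspace S; x \<in> S; y \<in> S\<rbrakk> \<Longrightarrow> loop q x y t \<in> S"
  unfolding loop_def by (intro subspace_add subspace_scale)

lemma loop_integral_period:
  fixes x y :: "'a::euclidean_space"
  assumes "q > 0"
  shows "(loop q x y has_integral 0) {0..1}"
  using has_integral_add[OF has_integral_scaleR_left[OF cos_integral_period[of "int q"], of x]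
      has_integral_scaleR_left[OF sin_integral_period[of "int q"], of y]] assms
  by (simp add: loop_def[abs_def])

text \<open>
  The primitive is, up to a constant vector and a factor, the loop rotated by a quarter period. The
  area form thus reduces to a bilinear form evaluated on two loops.
\<close>

lemma loop_primitive:
  fixes x y :: "'a::euclidean_space"
  assumes "q > 0" "t \<ge> 0"
  shows "integral {0..t} (loop q x y) = (1 / (2 * pi * real q)) *\<^sub>R (loop q (- y) x t + y)"
proof -
  define w where "w = 2 * pi * real q"
  have "w \<noteq> 0" using assms by (simp add: w_def)
  have "((\<lambda>s. cos (w * s)) has_integral (sin (w * t) / w - sin (w * 0) / w)) {0..t}"
    "((\<lambda>s. sin (w * s)) has_integral (- cos (w * t) / w - - cos (w * 0) / w)) {0..t}"
    using \<open>w \<noteq> 0\<close> \<open>t \<ge> 0\<close>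
    by (intro fundamental_theorem_of_calculus;
        auto intro!: derivative_eq_intros simp flip: has_real_derivative_iff_has_vector_derivative)+
  from has_integral_add[OF has_integral_scaleR_left[OF this(1), of x] has_integral_scaleR_left[OF this(2), of y]]
  have "(loop q x y has_integral (sin (w * t) / w) *\<^sub>R x + ((1 - cos (w * t)) / w) *\<^sub>R y) {0..t}"
    by (simp add: loop_def[abs_def] w_def diff_divide_distrib)
  moreover have "(1 / w) *\<^sub>R (loop q (- y) x t + y) = (sin (w * t) / w) *\<^sub>R x + ((1 - cos (w * t)) / w) *\<^sub>R y"
    by (simp add: loop_def w_def scaleR_add_right diff_divide_distrib scaleR_diff_left scaleR_diff_right)
  ultimately show ?thesis
    unfolding w_def by (simp add: integral_unique)
qed

text \<open>
  By the product formulas only the frequencies \<open>p - q\<close> and \<open>p + q\<close> occur, and a full period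
  integrates to zero unless the frequency is zero.
\<close>

lemma loop_bilinear_integral:
  fixes h :: "'a::euclidean_space \<Rightarrow> 'b::euclidean_space \<Rightarrow> 'c::euclidean_space"
  assumes h: "bilinear h" and "p > 0" "q > 0"
  shows "((\<lambda>t. h (loop p x y t) (loop q x' y' t)) has_integral
      (if p = q then (1/2) *\<^sub>R (h x x' + h y y') else 0)) {0..1}"
proof -
  let ?c = "\<lambda>k t. cos (2 * pi * of_int k * t)" and ?s = "\<lambda>k t. sin (2 * pi * of_int k * t)"
  let ?d = "int p - int q" and ?a = "int p + int q"
  have eq: "h (loop p x y t) (loop q x' y' t) =
      (?c ?d t + ?c ?a t) *\<^sub>R ((1/2) *\<^sub>R h x x') + (?c ?d t - ?c ?a t) *\<^sub>R ((1/2) *\<^sub>R h y y') +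
      (?s ?a t - ?s ?d t) *\<^sub>R ((1/2) *\<^sub>R h x y') + (?s ?a t + ?s ?d t) *\<^sub>R ((1/2) *\<^sub>R h y x')" for t
  proof -
    define A B where "A = 2 * pi * real p * t" and "B = 2 * pi * real q * t"
    have angles: "2 * pi * of_int ?d * t = A - B" "2 * pi * of_int ?a * t = A + B"
      by (simp_all add: A_def B_def algebra_simps)
    then show ?thesis
      unfolding loop_def A_def[symmetric] B_def[symmetric] angles
      by (simp add: bilinear_ladd[OF h] bilinear_radd[OF h] bilinear_lmul[OF h] bilinear_rmul[OF h]
          cos_add cos_diff sin_add sin_diff algebra_simps)
  qed
  have "((\<lambda>t. h (loop p x y t) (loop q x' y' t)) has_integral
      ((if ?d = 0 then 1 else 0) + (if ?a = 0 then 1 else 0)) *\<^sub>R ((1/2) *\<^sub>R h x x') +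
      ((if ?d = 0 then 1 else 0) - (if ?a = 0 then 1 else 0)) *\<^sub>R ((1/2) *\<^sub>R h y y') +
      (0 - 0) *\<^sub>R ((1/2) *\<^sub>R h x y') + (0 + 0) *\<^sub>R ((1/2) *\<^sub>R h y x')) {0..1}"
    unfolding eq
    by (intro has_integral_add has_integral_diff has_integral_scaleR_left
        cos_integral_period sin_integral_period)
  then show ?thesis
    using assms(2,3) by (simp add: scaleR_add_right split: if_splits)
qed

lemma loop_area_integral:
  fixes h :: "'a::euclidean_space \<Rightarrow> 'a \<Rightarrow> 'c::euclidean_space"
  assumes h: "bilinear h" and "p > 0" "q > 0"
  shows "((\<lambda>t. h (integral {0..t} (loop p x y)) (loop q x' y' t)) has_integral
      (if p = q then (1 / (4 * pi * real q)) *\<^sub>R (h x y' - h y x') else 0)) {0..1}"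
proof -
  have lin: "bounded_linear (h y)"
    using h by (simp add: bilinear_def linear_conv_bounded_linear)
  have "((\<lambda>t. (1 / (2 * pi * real p)) *\<^sub>R (h (loop p (- y) x t) (loop q x' y' t) + h y (loop q x' y' t)))
     has_integral (1 / (2 * pi * real p)) *\<^sub>R 
       ((if p = q then (1/2) *\<^sub>R (h (- y) x' + h x y') else 0) + h y 0)) {0..1}"
    using has_integral_linear[OF loop_integral_period[OF \<open>q > 0\<close>, of x' y'] lin]
    by (intro has_integral_cmul has_integral_add loop_bilinear_integral[OF h assms(2,3)])
      (simp add: o_def)
  then have "((\<lambda>t. (1 / (2 * pi * real p)) *\<^sub>R (h (loop p (- y) x t) (loop q x' y' t) + h y (loop q x' y' t)))
     has_integral (if p = q then (1 / (4 * pi * real q)) *\<^sub>R (h x y' - h y x') else 0)) {0..1}"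
    by (simp add: bilinear_lneg[OF h] bilinear_rzero[OF h] mult.assoc split: if_splits)
  then show ?thesis
    by (rule has_integral_eq[rotated])
      (simp add: loop_primitive[OF \<open>p > 0\<close>] bilinear_ladd[OF h] bilinear_lmul[OF h])
qed

text \<open>
  Distinct frequencies do not interact, so both quadratic functionals are diagonal on a combination
  of loops. With \<open>h\<close> the inner product the first is the energy; with \<open>h\<close> the bracket the second is
  twice the quadratic part of the endpoint.
\<close>

lemma loop_sum_integrals:
  fixes h :: "'a::euclidean_space \<Rightarrow> 'a \<Rightarrow> 'c::euclidean_space"
    and x y :: "'i \<Rightarrow> 'a" and q :: "'i \<Rightarrow> nat" and \<alpha> :: "'i \<Rightarrow> real"
  assumes h: "bilinear h" and P: "finite P" and inj: "inj_on q P" and pos: "\<And>p. p \<in> P \<Longrightarrow> q p > 0"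
  defines "v \<equiv> \<lambda>t. \<Sum>p\<in>P. \<alpha> p *\<^sub>R loop (q p) (x p) (y p) t"
  shows "((\<lambda>t. h (v t) (v t)) has_integral
            (\<Sum>p\<in>P. ((\<alpha> p)\<^sup>2 / 2) *\<^sub>R (h (x p) (x p) + h (y p) (y p)))) {0..1}"
    and "((\<lambda>t. h (integral {0..t} v) (v t)) has_integral
            (\<Sum>p\<in>P. ((\<alpha> p)\<^sup>2 / (4 * pi * real (q p))) *\<^sub>R (h (x p) (y p) - h (y p) (x p)))) {0..1}"
proof -
  let ?l = "\<lambda>p. loop (q p) (x p) (y p)"
  have sum2: "h (\<Sum>i\<in>P. \<alpha> i *\<^sub>R f i) (\<Sum>j\<in>P. \<alpha> j *\<^sub>R g j) 
        = (\<Sum>i\<in>P. \<Sum>j\<in>P. (\<alpha> i * \<alpha> j) *\<^sub>R h (f i) (g j))" for f g :: "_ \<Rightarrow> 'a"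
    by (subst bilinear_sum[OF h])
      (simp add: sum.cartesian_product bilinear_lmul[OF h] bilinear_rmul[OF h] P mult.commute)
  have diag: "(\<Sum>i\<in>P. \<Sum>j\<in>P. (\<alpha> i * \<alpha> j) *\<^sub>R (if q i = q j then z i j else 0))
       = (\<Sum>i\<in>P. (\<alpha> i)\<^sup>2 *\<^sub>R z i i)" for z :: "_ \<Rightarrow> _ \<Rightarrow> 'c"
  proof (rule sum.cong[OF refl])
    fix i assume "i \<in> P"
    have "(\<Sum>j\<in>P. (\<alpha> i * \<alpha> j) *\<^sub>R (if q i = q j then z i j else 0))
       = (\<Sum>j\<in>P. if j = i then (\<alpha> i)\<^sup>2 *\<^sub>R z i i else 0)"
      using inj \<open>i \<in> P\<close> by (intro sum.cong) (auto simp: power2_eq_square dest: inj_onD)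
    then show "(\<Sum>j\<in>P. (\<alpha> i * \<alpha> j) *\<^sub>R (if q i = q j then z i j else 0)) = (\<alpha> i)\<^sup>2 *\<^sub>R z i i"
      using P \<open>i \<in> P\<close> by simp
  qed
  have "((\<lambda>t. h (v t) (v t)) has_integral (\<Sum>i\<in>P. \<Sum>j\<in>P. (\<alpha> i * \<alpha> j) *\<^sub>R
      (if q i = q j then (1/2) *\<^sub>R (h (x i) (x j) + h (y i) (y j)) else 0))) {0..1}"
    unfolding v_def sum2
    by (intro has_integral_sum P has_integral_cmul loop_bilinear_integral h pos)
  then show "((\<lambda>t. h (v t) (v t)) has_integral
            (\<Sum>p\<in>P. ((\<alpha> p)\<^sup>2 / 2) *\<^sub>R (h (x p) (x p) + h (y p) (y p)))) {0..1}"
    unfolding diag by simp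
  have int: "integral {0..t} v = (\<Sum>p\<in>P. \<alpha> p *\<^sub>R integral {0..t} (?l p))" for t
    unfolding v_def using P
    by (subst integral_sum) (auto intro!: integrable_continuous_real continuous_intros continuous_on_loop)
  have "((\<lambda>t. h (integral {0..t} v) (v t)) has_integral (\<Sum>i\<in>P. \<Sum>j\<in>P. (\<alpha> i * \<alpha> j) *\<^sub>R
      (if q i = q j then (1 / (4 * pi * real (q j))) *\<^sub>R (h (x i) (y j) - h (y i) (x j)) else 0))) {0..1}"
    unfolding int unfolding v_def sum2
    by (intro has_integral_sum P has_integral_cmul loop_area_integral h pos)
  then show "((\<lambda>t. h (integral {0..t} v) (v t)) has_integral
            (\<Sum>p\<in>P. ((\<alpha> p)\<^sup>2 / (4 * pi * real (q p))) *\<^sub>R (h (x p) (y p) - h (y p) (x p)))) {0..1}"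
    unfolding diag by simp
qed

section \<open>Linear algebra\<close>

text \<open>
  There is one vector more than the dimension (the index starts at 0), so a nontrivial relation
  exists; it is homogeneous, so it can be scaled to any prescribed value of a positive definite
  diagonal quadratic form.
\<close>

lemma vanishing_combination:
  fixes l :: "nat \<Rightarrow> 'e::euclidean_space"
  assumes \<mu>: "\<And>i. \<mu> i > 0" and "r \<ge> 0"
  obtains \<alpha> :: "nat \<Rightarrow> real" where "(\<Sum>i\<le>DIM('e). \<alpha> i *\<^sub>R l i) = 0" "(\<Sum>i\<le>DIM('e). \<mu> i * (\<alpha> i)\<^sup>2) = r"
proof -
  let ?I = "{..DIM('e)}"
  obtain \<beta> k where \<beta>: "(\<Sum>i\<in>?I. \<beta> i *\<^sub>R l i) = 0" and k: "k \<in> ?I" "\<beta> k \<noteq> 0"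
  proof (cases "inj_on l ?I")
    case True
    have "dependent (l ` ?I)"
      using independent_bound[of "l ` ?I"] card_image[OF True] by force
    then obtain u where u: "\<exists>v\<in>l ` ?I. u v \<noteq> 0" "(\<Sum>v\<in>l ` ?I. u v *\<^sub>R v) = 0"
      by (auto simp: dependent_finite)
    have "(\<Sum>i\<in>?I. u (l i) *\<^sub>R l i) = 0"
      using u(2) by (simp add: sum.reindex[OF True])
    then show ?thesis using that[of "\<lambda>i. u (l i)"] u(1) by blast
  next
    case False
    then obtain i j where ij: "i \<in> ?I" "j \<in> ?I" "i \<noteq> j" "l i = l j" by (auto simp: inj_on_def)
    define \<beta> where "\<beta> m = (if m = i then 1 else 0) - (if m = j then 1 else 0 :: real)" for m
    have "(\<Sum>m\<in>?I. \<beta> m *\<^sub>R l m) = (\<Sum>m\<in>?I. (if m = i then l m else 0) - (if m = j then l m else 0))"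
      by (intro sum.cong) (auto simp: \<beta>_def)
    also have "\<dots> = 0"
      using ij by (simp add: sum_subtractf)
    finally show ?thesis using that[of \<beta> i] ij by (simp add: \<beta>_def)
  qed
  define s where "s = (\<Sum>i\<in>?I. \<mu> i * (\<beta> i)\<^sup>2)"
  have "\<mu> k * (\<beta> k)\<^sup>2 \<le> s"
    unfolding s_def using k(1) \<mu> by (intro member_le_sum) (auto simp: less_imp_le)
  moreover have "\<mu> k * (\<beta> k)\<^sup>2 > 0" using k(2) \<mu> by simp
  ultimately have "s > 0" by linarith
  show ?thesis
  proof (rule that[of "\<lambda>i. sqrt (r / s) * \<beta> i"])
    have "(\<Sum>i\<le>DIM('e). (sqrt (r / s) * \<beta> i) *\<^sub>R l i) = sqrt (r / s) *\<^sub>R (\<Sum>i\<in>?I. \<beta> i *\<^sub>R l i)"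
      by (simp add: scaleR_sum_right)
    then show "(\<Sum>i\<le>DIM('e). (sqrt (r / s) * \<beta> i) *\<^sub>R l i) = 0" using \<beta> by simp
    have "(\<Sum>i\<le>DIM('e). \<mu> i * (sqrt (r / s) * \<beta> i)\<^sup>2) = (\<Sum>i\<in>?I. (r / s) * (\<mu> i * (\<beta> i)\<^sup>2))"
      using \<open>s > 0\<close> \<open>r \<ge> 0\<close> by (intro sum.cong) (simp_all add: power_mult_distrib)
    also have "\<dots> = (r / s) * s" unfolding s_def by (rule sum_distrib_left[symmetric])
    finally have "(\<Sum>i\<le>DIM('e). \<mu> i * (sqrt (r / s) * \<beta> i)\<^sup>2) = (r / s) * s" .
    then show "(\<Sum>i\<le>DIM('e). \<mu> i * (sqrt (r / s) * \<beta> i)\<^sup>2) = r" using \<open>s > 0\<close> by simp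
  qed
qed

text \<open>
  Expansion in an orthonormal basis shows that \<open>N\<close> is Lipschitz on \<open>S\<close>, hence attains a positive
  minimum on the compact unit sphere of \<open>S\<close>.
\<close>

lemma norm_on_lower_bound:
  fixes N :: "'a::euclidean_space \<Rightarrow> real"
  assumes S: "subspace S" and N: "norm_on S N"
  obtains K where "K > 0" "\<And>x. x \<in> S \<Longrightarrow> norm x \<le> K * N x"
proof -
  have N0: "N x \<ge> 0" "N x = 0 \<longleftrightarrow> x = 0" if "x \<in> S" for x
    using N that by (auto simp: norm_on_def)
  have Nscale: "N (c *\<^sub>R x) = \<bar>c\<bar> * N x" if "x \<in> S" for x c
    using N that by (auto simp: norm_on_def)
  have Ntri: "N (x + y) \<le> N x + N y" if "x \<in> S" "y \<in> S" for x y
    using N that by (auto simp: norm_on_def)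
  have Nsum: "N (\<Sum>b\<in>B. c b *\<^sub>R b) \<le> (\<Sum>b\<in>B. \<bar>c b\<bar> * N b)" if "finite B" "B \<subseteq> S" for c B
    using that
  proof (induction B rule: finite_induct)
    case empty
    then show ?case using N0(2)[OF subspace_0[OF S]] by simp
  next
    case (insert b B)
    have "N (\<Sum>b\<in>insert b B. c b *\<^sub>R b) \<le> N (c b *\<^sub>R b) + N (\<Sum>b\<in>B. c b *\<^sub>R b)"
      using insert by (simp, intro Ntri) (auto intro!: subspace_sum subspace_scale S)
    then show ?case using insert by (simp add: Nscale)
  qed
  obtain B where B: "B \<subseteq> S" "pairwise orthogonal B" "\<And>x. x \<in> B \<Longrightarrow> norm x = 1"
    "independent B" "card B = dim S" "span B = S"
    using orthonormal_basis_subspace[OF S] by metis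
  have "finite B" using B(4) independent_imp_finite by blast
  define L where "L = (\<Sum>b\<in>B. N b)"
  have upper: "N x \<le> L * norm x" if "x \<in> S" for x
  proof -
    have "x = (\<Sum>b\<in>B. (x \<bullet> b) *\<^sub>R b)"
      using B \<open>finite B\<close> that by (intro orthonormal_basis_expand[symmetric]) auto
    then have "N x \<le> (\<Sum>b\<in>B. \<bar>x \<bullet> b\<bar> * N b)"
      using Nsum[OF \<open>finite B\<close> B(1)] by metis
    also have "\<dots> \<le> (\<Sum>b\<in>B. norm x * N b)"
    proof (intro sum_mono mult_right_mono)
      fix b assume "b \<in> B"
      then show "\<bar>x \<bullet> b\<bar> \<le> norm x" using Cauchy_Schwarz_ineq2[of x b] B(3) by simp
      show "0 \<le> N b" using N0(1) B(1) \<open>b \<in> B\<close> by blast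
    qed
    finally show ?thesis by (simp add: L_def sum_distrib_left mult.commute)
  qed
  have lip: "\<bar>N x - N y\<bar> \<le> L * norm (x - y)" if "x \<in> S" "y \<in> S" for x y
    using Ntri[of "x - y" y] Ntri[of "y - x" x] upper[of "x - y"] upper[of "y - x"] that
      subspace_diff[OF S] by (force simp: norm_minus_commute abs_le_iff)
  have "continuous_on S N"
  proof (rule lipschitz_on_continuous_on[of "\<bar>L\<bar>"], rule lipschitz_onI)
    fix x y assume "x \<in> S" "y \<in> S"
    then have "\<bar>N x - N y\<bar> \<le> L * norm (x - y)" by (rule lip)
    also have "\<dots> \<le> \<bar>L\<bar> * norm (x - y)" by (intro mult_right_mono) auto
    finally show "dist (N x) (N y) \<le> \<bar>L\<bar> * dist x y" by (simp add: dist_norm)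
  qed simp
  then have cont: "continuous_on (sphere 0 1 \<inter> S) N"
    by (rule continuous_on_subset) simp
  have "compact (sphere 0 1 \<inter> S)"
    using S by (intro compact_Int_closed closed_subspace) auto
  then obtain m where "m > 0" and m: "\<And>x. x \<in> sphere 0 1 \<inter> S \<Longrightarrow> m \<le> N x"
  proof (cases "sphere 0 1 \<inter> S = {}")
    case False
    obtain z where z: "z \<in> sphere 0 1 \<inter> S" "\<And>x. x \<in> sphere 0 1 \<inter> S \<Longrightarrow> N z \<le> N x"
      using continuous_attains_inf[OF \<open>compact _\<close> False cont] by blast
    then have "N z > 0" using N0[of z] by force
    then show ?thesis using that z(2) by blast
  qed (use that[of 1] in auto)
  show ?thesis
  proof (rule that[of "1 / m"])
    show "norm x \<le> 1 / m * N x" if "x \<in> S" for x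
    proof (cases "x = 0")
      case False
      have "m \<le> N ((1 / norm x) *\<^sub>R x)"
        using False that S by (intro m) (auto intro: subspace_scale)
      then show ?thesis using False \<open>m > 0\<close> that by (simp add: Nscale field_simps)
    qed (use N0(2)[OF subspace_0[OF S]] in simp)
  qed (use \<open>m > 0\<close> in simp)
qed

text \<open>
  The coordinates are functions on the whole space, so that they are bounded by multiples of the
  ambient norm.
\<close>

lemma linear_coordinates_from_spanning_set:
  fixes S :: "'a::euclidean_space set"
  obtains B c where "finite B" "B \<subseteq> S" "\<And>b. linear (c b :: 'a \<Rightarrow> real)"
    "\<And>x. x \<in> span S \<Longrightarrow> x = (\<Sum>b\<in>B. c b x *\<^sub>R b)"
proof -
  obtain B where B: "B \<subseteq> S" "independent B" "S \<subseteq> span B" 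
    using maximal_independent_subset by metis
  have "finite B" using B(2) independent_imp_finite by blast
  have "\<exists>f::'a \<Rightarrow> real. linear f \<and> (\<forall>b'\<in>B. f b' = (if b' = b then 1 else 0))" for b
    using linear_independent_extend[OF B(2), of "\<lambda>b'. if b' = b then 1 else 0"] .
  then obtain c :: "'a \<Rightarrow> 'a \<Rightarrow> real" where c: "\<And>b. linear (c b)" "\<And>b b'. b' \<in> B \<Longrightarrow> c b b' = (if b' = b then 1 else 0)"
    by metis
  have "x = (\<Sum>b\<in>B. c b x *\<^sub>R b)" if "x \<in> span S" for x
  proof -
    have "x \<in> span B" using that B(3) span_minimal subspace_span by blast
    moreover have "linear (\<lambda>x. \<Sum>b\<in>B. c b x *\<^sub>R b)"
      using c(1) by (intro linear_compose_sum ballI) (simp add: linear_iff algebra_simps)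
    moreover have "b' = (\<Sum>b\<in>B. c b b' *\<^sub>R b)" if "b' \<in> B" for b'
    proof -
      have "(\<Sum>b\<in>B. c b b' *\<^sub>R b) = (\<Sum>b\<in>B. if b' = b then b' else 0)"
        using c(2)[OF that] by (intro sum.cong) auto
      then show ?thesis using \<open>finite B\<close> that by simp
    qed
    ultimately show ?thesis
      using linear_eq_on[OF linear_id, of "\<lambda>x. \<Sum>b\<in>B. c b x *\<^sub>R b" x B] by simp
  qed
  then show ?thesis using that \<open>finite B\<close> B(1) c(1) by blast
qed

text \<open>
  The inner product of a sub-Riemannian structure is meaningful on its fibre only. Composing it with
  a linear projection onto the fibre gives a form to which results on bilinear maps of
  the whole space apply.
\<close>

lemma inner_product_on_bilinear_extension:
  fixes S :: "'a::euclidean_space set"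
  assumes S: "subspace S" and b: "inner_product_on S b"
  obtains \<beta> :: "'a \<Rightarrow> 'a \<Rightarrow> real" where "bilinear \<beta>" "\<And>x y. \<lbrakk>x \<in> S; y \<in> S\<rbrakk> \<Longrightarrow> \<beta> x y = b x y"
proof -
  obtain \<pi> where \<pi>: "range \<pi> \<subseteq> S" "linear \<pi>" "\<forall>v\<in>S. \<pi> v = v"
    using linear_exists_left_inverse_on[of "\<lambda>x::'a. x" S] S by (auto simp: linear_ident)
  have \<pi>S: "\<pi> x \<in> S" for x using \<pi>(1) by blast
  have sym: "b x y = b y x" and scale: "b (c *\<^sub>R x) y = c * b x y"
    if "x \<in> S" "y \<in> S" for x y c
    using b that unfolding inner_product_on_def by blast+
  have add: "b (x + y) z = b x z + b y z" if "x \<in> S" "y \<in> S" "z \<in> S" for x y z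
    using b that unfolding inner_product_on_def by blast
  have lin: "linear (\<lambda>x. b (\<pi> x) (\<pi> y))" for y
    using \<pi>S by (simp add: linear_iff linear_add[OF \<pi>(2)] linear_scale[OF \<pi>(2)] add scale)
  have "linear (\<lambda>y. b (\<pi> x) (\<pi> y))" for x
    unfolding sym[OF \<pi>S \<pi>S, of x] by (rule lin)
  with lin show ?thesis
    using that[of "\<lambda>x y. b (\<pi> x) (\<pi> y)"] \<pi>(3) by (simp add: bilinear_def)
qed

text \<open>
  Orthogonal projection onto \<open>W\<close> by the Gram-Schmidt process: a basis vector is first made orthogonal
  to its predecessors, and what remains of it is zero or has nonzero square by definiteness.
\<close>

lemma orthogonal_decomposition:
  fixes \<beta> :: "'a::euclidean_space \<Rightarrow> 'a \<Rightarrow> real"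
  assumes \<beta>: "bilinear \<beta>" and W: "subspace W" and pos: "\<And>w. \<lbrakk>w \<in> W; w \<noteq> 0\<rbrakk> \<Longrightarrow> \<beta> w w \<noteq> 0"
  obtains w where "w \<in> W" "\<And>y. y \<in> W \<Longrightarrow> \<beta> (x - w) y = 0"
proof -
  obtain B where B: "B \<subseteq> W" "independent B" "W \<subseteq> span B"
    using maximal_independent_subset by metis
  have spanB: "span B = W" using B W by (simp add: span_subspace)
  have "finite B" using B(2) independent_imp_finite by blast
  note lin = bilinear_ladd[OF \<beta>] bilinear_lsub[OF \<beta>] bilinear_lmul[OF \<beta>] bilinear_radd[OF \<beta>] bilinear_rmul[OF \<beta>]
  have "\<exists>w\<in>span B. \<forall>y\<in>span B. \<beta> (x - w) y = 0" for x
    using \<open>finite B\<close> B(1)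
  proof (induction B arbitrary: x rule: finite_induct)
    case empty
    then show ?case by (simp add: bilinear_rzero[OF \<beta>])
  next
    case (insert a B)
    then obtain wx wa where w: "wx \<in> span B" "\<And>y. y \<in> span B \<Longrightarrow> \<beta> (x - wx) y = 0"
         "wa \<in> span B" "\<And>y. y \<in> span B \<Longrightarrow> \<beta> (a - wa) y = 0"
      by (metis insert_subset)
    define a' where "a' = a - wa"
    show ?case
    proof (cases "a' = 0")
      case True
      then have "span (insert a B) = span B" using w(3) by (simp add: a'_def span_redundant)
      then show ?thesis using w by metis
    next
      case False
      have sub: "span B \<subseteq> span (insert a B)" by (intro span_mono) auto
      have a': "a' \<in> span (insert a B)"
        unfolding a'_def using w(3) sub by (intro span_diff) (auto intro: span_base)
      moreover have "span (insert a B) \<subseteq> W" using insert.prems W by (rule span_minimal)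
      ultimately have "\<beta> a' a' \<noteq> 0" using pos False by blast
      define k where "k = \<beta> (x - wx) a' / \<beta> a' a'"
      define w where "w = wx + k *\<^sub>R a'"
      have "w \<in> span (insert a B)"
        unfolding w_def using w(1) sub a' by (intro span_add span_scale) auto
      moreover have "\<beta> (x - w) y = 0" if y: "y \<in> span (insert a B)" for y
      proof -
        obtain m where m: "y - m *\<^sub>R a \<in> span B" using y by (auto simp: span_breakdown_eq)
        define s where "s = (y - m *\<^sub>R a) + m *\<^sub>R wa"
        have s: "s \<in> span B" unfolding s_def using m w(3) by (intro span_add span_scale)
        have "y = m *\<^sub>R a' + s" by (simp add: s_def a'_def algebra_simps)
        moreover have "x - w = (x - wx) - k *\<^sub>R a'" by (simp add: w_def)
        moreover have "\<beta> (x - wx) a' - k * \<beta> a' a' = 0" using \<open>\<beta> a' a' \<noteq> 0\<close> by (simp add: k_def)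
        ultimately show ?thesis
          using w(2)[OF s] w(4)[OF s] by (simp only: lin) (simp add: a'_def lin)
      qed
      ultimately show ?thesis by blast
    qed
  qed
  then show ?thesis using that spanB by metis
qed

text \<open>
  Both \<open>\<Delta>\<^sub>e\<close> modulo \<open>V\<close> and \<open>\<gg>\<close> modulo \<open>\<Delta>\<^sub>e\<close> are represented by elements of the derived algebra: the
  former by orthogonal projection, the latter because \<open>\<Delta>\<^sub>e + [\<gg>, \<gg>]\<close> is a subalgebra containing
  \<open>\<Delta>\<^sub>e\<close>. Such elements are central, so every bracket equals a bracket of two vectors of \<open>V\<close>.
\<close>

lemma span_bracket_orth_derived:
  assumes nil: "two_step_nilpotent br" and sr: "sub_riemannian br \<Delta> \<rho>"
  defines "V \<equiv> orth_derived br \<Delta> \<rho>"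
  shows "derived_algebra br \<subseteq> span {br x y | x y. x \<in> V \<and> y \<in> V}"
proof -
  note bil = two_step_bilinear[OF nil]
  note lin = bilinear_ladd[OF bil] bilinear_radd[OF bil]
  let ?D = "derived_algebra br"
  have \<Delta>: "subspace (\<Delta> 0)" and hull: "lie_subalgebra br hull \<Delta> 0 = UNIV" and ip: "inner_product_on (\<Delta> 0) (\<rho> 0)"
    using sr by (auto simp: sub_riemannian_def)
  have D: "subspace ?D" by (simp add: derived_algebra_def bracket_span_def)
  obtain \<beta> where \<beta>: "bilinear \<beta>" "\<And>x y. \<lbrakk>x \<in> \<Delta> 0; y \<in> \<Delta> 0\<rbrakk> \<Longrightarrow> \<beta> x y = \<rho> 0 x y"
    using inner_product_on_bilinear_extension[OF \<Delta> ip] by blast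
  have decomp: "\<exists>v\<in>V. x - v \<in> ?D" if x: "x \<in> \<Delta> 0" for x
  proof -
    obtain w where w: "w \<in> \<Delta> 0 \<inter> ?D" "\<And>y. y \<in> \<Delta> 0 \<inter> ?D \<Longrightarrow> \<beta> (x - w) y = 0"
    proof (rule orthogonal_decomposition[OF \<beta>(1), of "\<Delta> 0 \<inter> ?D"])
      show "\<beta> w w \<noteq> 0" if "w \<in> \<Delta> 0 \<inter> ?D" "w \<noteq> 0" for w
        using ip that \<beta>(2)[of w w] by (force simp: inner_product_on_def)
    qed (use \<Delta> D in \<open>auto intro: subspace_inter\<close>)
    have "x - w \<in> \<Delta> 0" using w(1) x by (auto intro: subspace_diff[OF \<Delta>])
    then have "x - w \<in> V" using w(2) \<beta>(2) by (auto simp: V_def orth_derived_def)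
    then show ?thesis using w(1) by force
  qed
  have br_mod: "br x y = br x' y'" if "x - x' \<in> ?D" "y - y' \<in> ?D" for x y x' y'
  proof -
    have "br x y = br (x' + (x - x')) (y' + (y - y'))" by simp
    also have "\<dots> = br x' y'"
      unfolding lin using that by (simp add: two_step_central[OF nil] two_step_central'[OF nil])
    finally show ?thesis .
  qed
  define T where "T = {a + z | a z. a \<in> \<Delta> 0 \<and> z \<in> ?D}"
  have "lie_subalgebra br T"
    unfolding lie_subalgebra_def
  proof (intro conjI ballI)
    show "subspace T" unfolding T_def by (rule subspace_sums[OF \<Delta> D])
    show "br x y \<in> T" for x y
      unfolding T_def using subspace_0[OF \<Delta>] bracket_in_derived[OF nil, of x y] by force
  qed
  moreover have "\<Delta> 0 \<subseteq> T" unfolding T_def using subspace_0[OF D] by force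
  ultimately have "T = UNIV" using hull_minimal[of "\<Delta> 0" T "lie_subalgebra br"] hull by auto
  have all: "\<exists>v\<in>V. x - v \<in> ?D" for x
  proof -
    obtain a z where az: "x = a + z" "a \<in> \<Delta> 0" "z \<in> ?D" using \<open>T = UNIV\<close> T_def by blast
    obtain v where "v \<in> V" "a - v \<in> ?D" using decomp az(2) by blast
    moreover have "x - v = (a - v) + z" using az by simp
    ultimately show ?thesis using subspace_add[OF D] az(3) by metis
  qed
  have "br x y \<in> {br x y | x y. x \<in> V \<and> y \<in> V}" for x y
    using all[of x] all[of y] br_mod by blast
  then show ?thesis
    unfolding derived_algebra_def bracket_span_def by (intro span_mono) blast
qed

section \<open>Endpoint correction\<close>

text \<open>
  The linear conditions on a perturbation \<open>v\<close>: twice the part of the endpoint displacement that is linear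
  in \<open>v\<close>, and the inner product of \<open>v\<close> with \<open>u\<close>. Collecting them in one vector makes their number
  the dimension of the target space.
\<close>

definition first_variation ::
  "('g::euclidean_space \<Rightarrow> 'g \<Rightarrow> 'g) \<Rightarrow> ('g \<Rightarrow> 'g \<Rightarrow> real) \<Rightarrow> (real \<Rightarrow> 'g) \<Rightarrow> (real \<Rightarrow> 'g) \<Rightarrow> 'g \<times> real" where
  "first_variation br \<beta> u v =
     (integral {0..1} (\<lambda>t. br (integral {0..t} u) (v t) + br (integral {0..t} v) (u t)),
      integral {0..1} (\<lambda>t. \<beta> (v t) (u t)))"

lemma first_variation_sum:
  assumes br: "bilinear br" and \<beta>: "bilinear \<beta>" and u: "u absolutely_integrable_on {0..1}"
    and P: "finite P" and z: "\<And>p. p \<in> P \<Longrightarrow> continuous_on {0..1} (z p)"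
  shows "first_variation br \<beta> u (\<lambda>t. \<Sum>p\<in>P. \<alpha> p *\<^sub>R z p t) = (\<Sum>p\<in>P. \<alpha> p *\<^sub>R first_variation br \<beta> u (z p))"
proof -
  have zi: "z p absolutely_integrable_on {0..1}" if "p \<in> P" for p
    using z[OF that] by (rule absolutely_integrable_continuous_real)
  have sub: "z p integrable_on {0..t}" if "p \<in> P" "t \<in> {0..1}" for p t
    using zi[OF that(1)] that(2) by (auto simp: absolutely_integrable_on_def intro: integrable_on_subinterval)
  have prim: "continuous_on {0..1} (\<lambda>t. integral {0..t} u)" "\<And>p. p \<in> P \<Longrightarrow> continuous_on {0..1} (\<lambda>t. integral {0..t} (z p))"
    using u zi by (auto intro!: indefinite_integral_continuous_1 simp: absolutely_integrable_on_def)
  have I1: "(\<lambda>t. br (integral {0..t} u) (z p t) + br (integral {0..t} (z p)) (u t)) integrable_on {0..1}" if "p \<in> P" for p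
    using absolutely_integrable_bilinear_continuous[OF br prim(1) zi[OF that]]
      absolutely_integrable_bilinear_continuous[OF br prim(2)[OF that] u]
    by (auto simp: absolutely_integrable_on_def intro: integrable_add)
  have I2: "(\<lambda>t. \<beta> (z p t) (u t)) integrable_on {0..1}" if "p \<in> P" for p
    using absolutely_integrable_bilinear_continuous[OF \<beta> z[OF that] u] by (simp add: absolutely_integrable_on_def)
  have lsum: "h (\<Sum>p\<in>P. \<alpha> p *\<^sub>R f p) y = (\<Sum>p\<in>P. \<alpha> p *\<^sub>R h (f p) y)"
    and rsum: "h y (\<Sum>p\<in>P. \<alpha> p *\<^sub>R f p) = (\<Sum>p\<in>P. \<alpha> p *\<^sub>R h y (f p))"
    if h: "bilinear h" for h :: "'a \<Rightarrow> 'a \<Rightarrow> 'c::euclidean_space" and f y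
  proof -
    have "linear (\<lambda>x. h x y)" "linear (h y)" using h by (auto simp: bilinear_def)
    note sums = linear_sum[OF this(1)] linear_sum[OF this(2)]
    show "h (\<Sum>p\<in>P. \<alpha> p *\<^sub>R f p) y = (\<Sum>p\<in>P. \<alpha> p *\<^sub>R h (f p) y)"
      and "h y (\<Sum>p\<in>P. \<alpha> p *\<^sub>R f p) = (\<Sum>p\<in>P. \<alpha> p *\<^sub>R h y (f p))"
      by (simp_all add: sums bilinear_lmul[OF h] bilinear_rmul[OF h])
  qed
  have "integral {0..1} (\<lambda>t. br (integral {0..t} u) (\<Sum>p\<in>P. \<alpha> p *\<^sub>R z p t) + br (integral {0..t} (\<lambda>t. \<Sum>p\<in>P. \<alpha> p *\<^sub>R z p t)) (u t))
     = integral {0..1} (\<lambda>t. \<Sum>p\<in>P. \<alpha> p *\<^sub>R (br (integral {0..t} u) (z p t) + br (integral {0..t} (z p)) (u t)))"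
  proof (rule integral_cong)
    fix t :: real assume t: "t \<in> {0..1}"
    have "integral {0..t} (\<lambda>t. \<Sum>p\<in>P. \<alpha> p *\<^sub>R z p t) = (\<Sum>p\<in>P. \<alpha> p *\<^sub>R integral {0..t} (z p))"
      using P sub[OF _ t] by (subst Henstock_Kurzweil_Integration.integral_sum) (auto intro!: integrable_cmul)
    then show "br (integral {0..t} u) (\<Sum>p\<in>P. \<alpha> p *\<^sub>R z p t) + br (integral {0..t} (\<lambda>t. \<Sum>p\<in>P. \<alpha> p *\<^sub>R z p t)) (u t)
       = (\<Sum>p\<in>P. \<alpha> p *\<^sub>R (br (integral {0..t} u) (z p t) + br (integral {0..t} (z p)) (u t)))"
      by (simp add: lsum[OF br] rsum[OF br] scaleR_add_right sum.distrib)
  qed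
  also have "\<dots> = (\<Sum>p\<in>P. \<alpha> p *\<^sub>R integral {0..1} (\<lambda>t. br (integral {0..t} u) (z p t) + br (integral {0..t} (z p)) (u t)))"
    using P I1 by (subst Henstock_Kurzweil_Integration.integral_sum) (auto intro!: integrable_cmul)
  finally have 1: "integral {0..1} (\<lambda>t. br (integral {0..t} u) (\<Sum>p\<in>P. \<alpha> p *\<^sub>R z p t) + br (integral {0..t} (\<lambda>t. \<Sum>p\<in>P. \<alpha> p *\<^sub>R z p t)) (u t)) = \<dots>" .
  have 2: "integral {0..1} (\<lambda>t. \<beta> (\<Sum>p\<in>P. \<alpha> p *\<^sub>R z p t) (u t)) = (\<Sum>p\<in>P. \<alpha> p *\<^sub>R integral {0..1} (\<lambda>t. \<beta> (z p t) (u t)))"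
    unfolding lsum[OF \<beta>] using P I2
    by (subst Henstock_Kurzweil_Integration.integral_sum)
      (auto intro: integrable_cmul simp del: real_scaleR_def)
  show ?thesis
    unfolding first_variation_def 1 2 by (simp add: prod_eq_iff fst_sum snd_sum)
qed

lemma L2_space_absolutely_integrable:
  assumes "u \<in> L2_space S"
  shows "u absolutely_integrable_on {0..1}"
proof (rule measurable_bounded_by_integrable_imp_absolutely_integrable)
  show "u \<in> borel_measurable (lebesgue_on {0..1})" using assms by (simp add: L2_space_def)
  have "(\<lambda>t. (norm (u t))\<^sup>2) integrable_on {0..1}"
    using assms by (intro integrable_on_lebesgue_on) (auto simp: L2_space_def)
  then show "(\<lambda>t. 1 + (norm (u t))\<^sup>2) integrable_on {0..1}"
    by (intro integrable_add) auto
  show "norm (u t) \<le> 1 + (norm (u t))\<^sup>2" for t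
    using zero_le_power2[of "norm (u t) - 1"] by (simp add: power2_diff) (smt (verit) norm_ge_zero)
qed simp

lemma continuous_in_L2_space:
  assumes "continuous_on {0..1} v" "\<And>t. v t \<in> S"
  shows "v \<in> L2_space S"
proof -
  have "v \<in> borel_measurable (lebesgue_on {0..1})"
    using assms(1) by (intro continuous_imp_measurable_on_sets_lebesgue) auto
  moreover have "integrable (lebesgue_on {0..1}) (\<lambda>t. (norm (v t))\<^sup>2)"
    using assms(1)
    by (intro absolutely_integrable_imp_integrable absolutely_integrable_continuous_real continuous_intros) auto
  ultimately show ?thesis using assms(2) by (simp add: L2_space_def)
qed

text \<open>
  Since \<open>u\<close> takes values in \<open>S\<close> almost everywhere only, \<open>b (v t) (u t)\<close> and its bilinear extension
  agree just off a null set.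
\<close>

lemma lebesgue_integral_bilinear_extension:
  fixes b \<beta> :: "'g::euclidean_space \<Rightarrow> 'g \<Rightarrow> real"
  assumes \<beta>: "bilinear \<beta>" and eq: "\<And>x y. \<lbrakk>x \<in> S; y \<in> S\<rbrakk> \<Longrightarrow> \<beta> x y = b x y"
    and v: "continuous_on {0..1} v" "\<And>t. v t \<in> S" and u: "u \<in> L2_space S"
  shows "(LINT t|lebesgue_on {0..1}. b (v t) (u t)) = integral {0..1} (\<lambda>t. \<beta> (v t) (u t))"
proof -
  obtain E where E: "negligible E" "\<And>t. t \<in> {0..1} - E \<Longrightarrow> u t \<in> S"
    using u by (auto simp: L2_space_def AE_lebesgue_on_iff_negligible)
  have "(\<lambda>t. \<beta> (v t) (u t)) absolutely_integrable_on {0..1}"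
    using absolutely_integrable_bilinear_continuous[OF \<beta> v(1) L2_space_absolutely_integrable[OF u]] .
  then have "(\<lambda>t. b (v t) (u t)) absolutely_integrable_on {0..1}"
    by (rule absolutely_integrable_spike[OF _ E(1)]) (use E(2) v(2) eq in auto)
  then have "(LINT t|lebesgue_on {0..1}. b (v t) (u t)) = integral {0..1} (\<lambda>t. b (v t) (u t))"
    by (intro lebesgue_integral_eq_integral absolutely_integrable_imp_integrable) auto
  also have "\<dots> = integral {0..1} (\<lambda>t. \<beta> (v t) (u t))"
    by (rule integral_spike[OF E(1)]) (use E(2) v(2) eq in auto)
  finally show ?thesis .
qed

theorem lemma3p1:
  fixes br :: "'g::euclidean_space \<Rightarrow> 'g \<Rightarrow> 'g"
    and \<Delta> :: "'g \<Rightarrow> 'g set"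
    and \<rho> :: "'g \<Rightarrow> 'g \<Rightarrow> 'g \<Rightarrow> real"
    and N :: "'g \<Rightarrow> real"
  assumes "two_step_nilpotent br"
    and "sub_riemannian br \<Delta> \<rho>"
    and "norm_on (derived_algebra br) N"
  shows "\<exists>C>0. \<forall>u \<in> L2_space (\<Delta> 0). \<forall>\<zeta> \<in> derived_algebra br.
    \<exists>v \<in> L2_space (orth_derived br \<Delta> \<rho>).
      curve_of br (\<lambda>t. u t + v t) 1 = curve_of br u 1 + \<zeta> \<and>
      (LINT t|lebesgue_on {0..1}. \<rho> 0 (v t) (u t)) = 0 \<and>
      (LINT t|lebesgue_on {0..1}. \<rho> 0 (v t) (v t)) \<le> C * N \<zeta>"
proof -
  note nil = assms(1)
  note bil = two_step_bilinear[OF nil]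
  let ?D = "derived_algebra br"
  define V where "V = orth_derived br \<Delta> \<rho>"
  have \<Delta>: "subspace (\<Delta> 0)" and ip: "inner_product_on (\<Delta> 0) (\<rho> 0)"
    using assms(2) by (auto simp: sub_riemannian_def)
  obtain \<beta> where \<beta>: "bilinear \<beta>" "\<And>x y. \<lbrakk>x \<in> \<Delta> 0; y \<in> \<Delta> 0\<rbrakk> \<Longrightarrow> \<beta> x y = \<rho> 0 x y"
    using inner_product_on_bilinear_extension[OF \<Delta> ip] by blast
  have \<beta>_nonneg: "\<beta> x x \<ge> 0" if "x \<in> \<Delta> 0" for x
    using ip \<beta>(2)[OF that that] that bilinear_lzero[OF \<beta>(1), of 0]
    by (cases "x = 0") (auto simp: inner_product_on_def less_imp_le)
  have V\<Delta>: "V \<subseteq> \<Delta> 0" by (auto simp: V_def orth_derived_def)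
  have "V = {v \<in> \<Delta> 0. \<forall>w\<in>\<Delta> 0 \<inter> ?D. \<beta> v w = 0}"
    using \<beta>(2) by (auto simp: V_def orth_derived_def)
  then have V: "subspace V"
    using \<Delta> by (auto simp: subspace_def bilinear_lzero[OF \<beta>(1)] bilinear_ladd[OF \<beta>(1)] bilinear_lmul[OF \<beta>(1)])
  obtain K where "K > 0" and K: "\<And>x. x \<in> ?D \<Longrightarrow> norm x \<le> K * N x"
    using norm_on_lower_bound[OF _ assms(3)] by (auto simp: derived_algebra_def bracket_span_def)
  have N_nonneg: "N x \<ge> 0" if "x \<in> ?D" for x using assms(3) that by (auto simp: norm_on_def)
  obtain B c where "finite B" and B: "B \<subseteq> {br x y | x y. x \<in> V \<and> y \<in> V}"
    and c_lin: "\<And>b. linear (c b :: 'g \<Rightarrow> real)"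
    and "\<And>x. x \<in> span {br x y | x y. x \<in> V \<and> y \<in> V} \<Longrightarrow> x = (\<Sum>b\<in>B. c b x *\<^sub>R b)"
    using linear_coordinates_from_spanning_set[of "{br x y | x y. x \<in> V \<and> y \<in> V}"] by blast
  then have coord: "x = (\<Sum>b\<in>B. c b x *\<^sub>R b)" if "x \<in> ?D" for x
    using span_bracket_orth_derived[OF nil assms(2)] that unfolding V_def by blast
  have "\<forall>b. \<exists>k>0. \<forall>x. norm (c b x) \<le> k * norm x"
    using linear_bounded_pos[OF c_lin] by metis
  then obtain k where k: "\<And>b. k b > 0" "\<And>b x. \<bar>c b x\<bar> \<le> k b * norm x"
    by (metis real_norm_def)
  have c_le: "\<bar>c b x\<bar> \<le> k b * K * N x" if "x \<in> ?D" for b x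
    using order_trans[OF k(2)[of b x] mult_left_mono[OF K[OF that]]] k(1)[of b] by (simp add: mult.assoc)
  have "\<forall>b\<in>B. \<exists>x y. x \<in> V \<and> y \<in> V \<and> b = br x y" using B by blast
  then obtain X Y where XY: "\<And>b. b \<in> B \<Longrightarrow> X b \<in> V \<and> Y b \<in> V \<and> b = br (X b) (Y b)"
    by metis
  \<comment> \<open>Each spanning bracket \<open>b\<close> gets \<open>n + 1\<close> loops, one more than there are linear conditions. All
      frequencies \<open>q (b, i)\<close> are distinct, and they are bounded by \<open>Q\<close> independently of \<open>u\<close>.\<close>
  define n where "n = DIM('g \<times> real)"
  define P where "P = B \<times> {..n}"
  have "finite P" using \<open>finite B\<close> by (simp add: P_def)
  obtain f :: "'g \<times> nat \<Rightarrow> nat" where "inj_on f P"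
    using finite_imp_inj_to_nat_seg[OF \<open>finite P\<close>] by metis
  define q where "q p = Suc (f p)" for p
  have q: "inj_on q P" "\<And>p. q p > 0"
    using \<open>inj_on f P\<close> by (auto simp: q_def inj_on_def)
  define Q where "Q = real (\<Sum>p\<in>P. q p)"
  have qQ: "real (q p) \<le> Q" if "p \<in> P" for p
    unfolding Q_def of_nat_le_iff using that \<open>finite P\<close> by (intro member_le_sum) auto
  define R where "R b = \<beta> (X b) (X b) + \<beta> (Y b) (Y b)" for b
  have R: "R b \<ge> 0" if "b \<in> B" for b
    unfolding R_def using XY[OF that] V\<Delta> by (intro add_nonneg_nonneg \<beta>_nonneg) auto
  \<comment> \<open>The loops of \<open>b\<close> have energy at most \<open>R b / 2 * \<Sum> \<alpha>\<^sup>2\<close>, which is at most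
      \<open>R b * \<pi> * Q * \<Sum> \<alpha>\<^sup>2 / (2\<pi>q)\<close>. The last sum will be twice the absolute value of the
      coefficient of \<open>b\<close> in \<open>\<zeta>\<close>, which is at most \<open>k b * K * N \<zeta>\<close>. The summand 1 ensures positivity.\<close>
  define C where "C = 1 + (\<Sum>b\<in>B. R b * (2 * pi * Q) * (k b * K))"
  have "Q \<ge> 0" by (simp add: Q_def sum_nonneg)
  have "C > 0"
    unfolding C_def using R k(1) \<open>K > 0\<close> \<open>Q \<ge> 0\<close> 
    by (intro add_pos_nonneg sum_nonneg mult_nonneg_nonneg) (auto simp: less_imp_le)
  have "\<exists>v \<in> L2_space V.
      curve_of br (\<lambda>t. u t + v t) 1 = curve_of br u 1 + \<zeta> \<and>
      (LINT t|lebesgue_on {0..1}. \<rho> 0 (v t) (u t)) = 0 \<and>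
      (LINT t|lebesgue_on {0..1}. \<rho> 0 (v t) (v t)) \<le> C * N \<zeta>"
    if u: "u \<in> L2_space (\<Delta> 0)" and \<zeta>: "\<zeta> \<in> ?D" for u \<zeta>
  proof -
    have ui: "u absolutely_integrable_on {0..1}" using L2_space_absolutely_integrable[OF u] .
    \<comment> \<open>A sum of squares only yields nonnegative areas; the sign of the coefficient goes into the
        orientation of the loop.\<close>
    define Y' where "Y' b = sgn (c b \<zeta>) *\<^sub>R Y b" for b
    define z where "z p = loop (q p) (X (fst p)) (Y' (fst p))" for p
    have Y': "Y' b \<in> V" if "b \<in> B" for b
      unfolding Y'_def using XY[OF that] V by (auto intro: subspace_scale)
    have z_cont: "continuous_on T (z p)" for T p
      unfolding z_def by (rule continuous_on_loop)
    have zV: "z p t \<in> V" if "p \<in> P" for p t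
      unfolding z_def using that XY Y' V by (intro loop_in_subspace) (auto simp: P_def)
    \<comment> \<open>The loop \<open>(b, i)\<close> sweeps out \<open>b\<close> up to the factor \<open>1 / (2\<pi>q)\<close> and the sign. The total for \<open>b\<close>
        is to be twice the coefficient of \<open>\<zeta>\<close>, as the area enters the endpoint with factor one half.\<close>
    have "\<exists>\<alpha>. (\<Sum>i\<le>n. \<alpha> i *\<^sub>R first_variation br \<beta> u (z (b,i))) = 0 \<and>
         (\<Sum>i\<le>n. 1 / (2 * pi * real (q (b,i))) * (\<alpha> i)\<^sup>2) = 2 * \<bar>c b \<zeta>\<bar>" for b
    proof -
      have "1 / (2 * pi * real (q (b,i))) > 0" for i using q(2) by simp
      then show ?thesis
        using vanishing_combination[of "\<lambda>i. 1 / (2 * pi * real (q (b,i)))" "2 * \<bar>c b \<zeta>\<bar>"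
          "\<lambda>i. first_variation br \<beta> u (z (b,i))" ?thesis]
        unfolding n_def by auto
    qed
    then have "\<exists>\<alpha>. \<forall>b. (\<Sum>i\<le>n. \<alpha> b i *\<^sub>R first_variation br \<beta> u (z (b,i))) = 0 \<and>
         (\<Sum>i\<le>n. 1 / (2 * pi * real (q (b,i))) * (\<alpha> b i)\<^sup>2) = 2 * \<bar>c b \<zeta>\<bar>"
      by (intro choice allI)
    then obtain \<alpha>' where \<alpha>': "\<And>b. (\<Sum>i\<le>n. \<alpha>' b i *\<^sub>R first_variation br \<beta> u (z (b,i))) = 0"
         "\<And>b. (\<Sum>i\<le>n. 1 / (2 * pi * real (q (b,i))) * (\<alpha>' b i)\<^sup>2) = 2 * \<bar>c b \<zeta>\<bar>"
      by blast
    define \<alpha> where "\<alpha> p = \<alpha>' (fst p) (snd p)" for p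
    define v where "v t = (\<Sum>p\<in>P. \<alpha> p *\<^sub>R z p t)" for t
    have v_cont: "continuous_on {0..1} v"
      unfolding v_def[abs_def] by (intro continuous_intros z_cont)
    have vV: "v t \<in> V" for t
      unfolding v_def by (intro subspace_sum subspace_scale V zV)
    have vL2: "v \<in> L2_space V" using continuous_in_L2_space[OF v_cont vV] .
    have "first_variation br \<beta> u v = (\<Sum>p\<in>P. \<alpha> p *\<^sub>R first_variation br \<beta> u (z p))"
      unfolding v_def[abs_def] by (rule first_variation_sum[OF bil \<beta>(1) ui \<open>finite P\<close> z_cont])
    also have "\<dots> = 0"
      by (simp add: P_def \<alpha>_def sum.cartesian_product' \<alpha>'(1))
    finally have fv: "integral {0..1} (\<lambda>t. br (integral {0..t} u) (v t) + br (integral {0..t} v) (u t)) = 0"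
      "integral {0..1} (\<lambda>t. \<beta> (v t) (u t)) = 0"
      by (simp_all add: first_variation_def zero_prod_def)
    have closed: "integral {0..1} v = 0"
    proof -
      have "(v has_integral (\<Sum>p\<in>P. \<alpha> p *\<^sub>R 0)) {0..1}"
        unfolding v_def[abs_def] z_def
        by (intro has_integral_sum has_integral_cmul loop_integral_period q \<open>finite P\<close>)
      then show ?thesis by (simp add: integral_unique)
    qed
    note ints = loop_sum_integrals[of _ P q \<alpha> "\<lambda>p. X (fst p)" "\<lambda>p. Y' (fst p)", OF _ \<open>finite P\<close> q,
        folded z_def, folded v_def]
    have area: "integral {0..1} (\<lambda>t. br (integral {0..t} v) (v t)) = 2 *\<^sub>R \<zeta>"
    proof -
      have "integral {0..1} (\<lambda>t. br (integral {0..t} v) (v t)) = 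
          (\<Sum>p\<in>P. ((\<alpha> p)\<^sup>2 / (4 * pi * real (q p))) *\<^sub>R (br (X (fst p)) (Y' (fst p)) - br (Y' (fst p)) (X (fst p))))"
        using ints(2)[OF bil] by (rule integral_unique)
      also have "\<dots> = (\<Sum>p\<in>P. (1 / (2 * pi * real (q p)) * (\<alpha> p)\<^sup>2) *\<^sub>R (sgn (c (fst p) \<zeta>) *\<^sub>R fst p))"
      proof (rule sum.cong[OF refl])
        fix p assume "p \<in> P"
        then have "fst p = br (X (fst p)) (Y (fst p))" using XY by (auto simp: P_def)
        then have "br (X (fst p)) (Y' (fst p)) = sgn (c (fst p) \<zeta>) *\<^sub>R fst p"
          by (simp add: Y'_def bilinear_rmul[OF bil])
        then show "((\<alpha> p)\<^sup>2 / (4 * pi * real (q p))) *\<^sub>R (br (X (fst p)) (Y' (fst p)) - br (Y' (fst p)) (X (fst p)))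
          = (1 / (2 * pi * real (q p)) * (\<alpha> p)\<^sup>2) *\<^sub>R (sgn (c (fst p) \<zeta>) *\<^sub>R fst p)"
          using two_step_skew[OF nil, of "Y' (fst p)" "X (fst p)"] by (simp add: mult_ac flip: scaleR_2)
      qed
      also have "\<dots> = (\<Sum>b\<in>B. \<Sum>i\<le>n. (1 / (2 * pi * real (q (b,i))) * (\<alpha>' b i)\<^sup>2) *\<^sub>R (sgn (c b \<zeta>) *\<^sub>R b))"
        by (simp add: P_def \<alpha>_def sum.cartesian_product')
      also have "\<dots> = (\<Sum>b\<in>B. 2 *\<^sub>R (c b \<zeta> *\<^sub>R b))"
        unfolding scaleR_sum_left[symmetric] \<alpha>'(2) by (simp add: mult.assoc abs_mult_sgn)
      also have "\<dots> = 2 *\<^sub>R \<zeta>"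
        unfolding scaleR_sum_right[symmetric] using coord[OF \<zeta>] by simp
      finally show ?thesis .
    qed
    have energy: "integral {0..1} (\<lambda>t. \<beta> (v t) (v t)) \<le> C * N \<zeta>"
    proof -
      have "integral {0..1} (\<lambda>t. \<beta> (v t) (v t)) = 
          (\<Sum>p\<in>P. ((\<alpha> p)\<^sup>2 / 2) *\<^sub>R (\<beta> (X (fst p)) (X (fst p)) + \<beta> (Y' (fst p)) (Y' (fst p))))"
        using ints(1)[OF \<beta>(1)] by (rule integral_unique)
      also have "\<dots> \<le> (\<Sum>p\<in>P. R (fst p) * (pi * Q) * (1 / (2 * pi * real (q p)) * (\<alpha> p)\<^sup>2))"
      proof (rule sum_mono)
        fix p assume p: "p \<in> P"
        then have b: "fst p \<in> B" by (auto simp: P_def)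
        have "\<beta> (Y' (fst p)) (Y' (fst p)) = (sgn (c (fst p) \<zeta>))\<^sup>2 * \<beta> (Y (fst p)) (Y (fst p))"
          by (simp add: Y'_def bilinear_lmul[OF \<beta>(1)] bilinear_rmul[OF \<beta>(1)] power2_eq_square)
        also have "\<dots> \<le> 1 * \<beta> (Y (fst p)) (Y (fst p))"
          using XY[OF b] V\<Delta> by (intro mult_right_mono \<beta>_nonneg) (auto simp: sgn_if)
        finally have 1: "\<beta> (X (fst p)) (X (fst p)) + \<beta> (Y' (fst p)) (Y' (fst p)) \<le> R (fst p)"
          by (simp add: R_def)
        have "((\<alpha> p)\<^sup>2 / 2) *\<^sub>R (\<beta> (X (fst p)) (X (fst p)) + \<beta> (Y' (fst p)) (Y' (fst p))) \<le> (\<alpha> p)\<^sup>2 / 2 * R (fst p)"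
          using 1 by (simp add: mult_left_mono)
        also have "\<dots> = R (fst p) * (pi * real (q p)) * (1 / (2 * pi * real (q p)) * (\<alpha> p)\<^sup>2)"
          using q(2)[of p] by simp
        also have "\<dots> \<le> R (fst p) * (pi * Q) * (1 / (2 * pi * real (q p)) * (\<alpha> p)\<^sup>2)"
          using qQ[OF p] R[OF b] by (intro mult_right_mono mult_left_mono) auto
        finally show "((\<alpha> p)\<^sup>2 / 2) *\<^sub>R (\<beta> (X (fst p)) (X (fst p)) + \<beta> (Y' (fst p)) (Y' (fst p)))
           \<le> R (fst p) * (pi * Q) * (1 / (2 * pi * real (q p)) * (\<alpha> p)\<^sup>2)" .
      qed
      also have "\<dots> = (\<Sum>b\<in>B. \<Sum>i\<le>n. R b * (pi * Q) * (1 / (2 * pi * real (q (b,i))) * (\<alpha>' b i)\<^sup>2))"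
        by (simp add: P_def \<alpha>_def sum.cartesian_product')
      also have "\<dots> = (\<Sum>b\<in>B. R b * (2 * pi * Q) * \<bar>c b \<zeta>\<bar>)"
        unfolding sum_distrib_left[symmetric] \<alpha>'(2) by (simp add: algebra_simps)
      also have "\<dots> \<le> (\<Sum>b\<in>B. R b * (2 * pi * Q) * (k b * K * N \<zeta>))"
        using R \<open>Q \<ge> 0\<close> c_le[OF \<zeta>] by (intro sum_mono mult_left_mono) auto
      also have "\<dots> = (C - 1) * N \<zeta>"
        by (simp add: C_def sum_distrib_right mult.assoc)
      also have "\<dots> \<le> C * N \<zeta>" using N_nonneg[OF \<zeta>] by (simp add: algebra_simps)
      finally show ?thesis .
    qed
    have "curve_of br (\<lambda>t. u t + v t) 1 = curve_of br u 1 + \<zeta>"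
      using curve_of_add_endpoint[OF nil ui v_cont closed] by (simp add: fv(1) area)
    moreover have "(LINT t|lebesgue_on {0..1}. \<rho> 0 (v t) (u t)) = 0"
      using lebesgue_integral_bilinear_extension[OF \<beta> v_cont _ u] vV V\<Delta> fv(2) by auto
    moreover have "v \<in> L2_space (\<Delta> 0)"
      using v_cont vV V\<Delta> by (intro continuous_in_L2_space) auto
    then have "(LINT t|lebesgue_on {0..1}. \<rho> 0 (v t) (v t)) = integral {0..1} (\<lambda>t. \<beta> (v t) (v t))"
      using vV V\<Delta> by (intro lebesgue_integral_bilinear_extension[OF \<beta> v_cont]) auto
    then have "(LINT t|lebesgue_on {0..1}. \<rho> 0 (v t) (v t)) \<le> C * N \<zeta>"
      using energy by simp
    ultimately show ?thesis using vL2 by blast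
  qed
  then show ?thesis using \<open>C > 0\<close> unfolding V_def by blast
qed

end
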